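(* Let $\epsilon>0$. In the asymmetric streaming model with an offline string $\bar{s}$ and an online string $s$, both of length $n$, there exists a single-pass deterministic streaming algorithm that finds a $(1+\epsilon)$-approximation of the edit distance $\mathrm{ed}(s,\bar{s})$ (a value $D$ with $\mathrm{ed}(s,\bar{s})\le D\le(1+\epsilon)\,\mathrm{ed}(s,\bar{s})$) using $\tilde{O}(\sqrt{n}/\epsilon)$ memory.
   Context: $\mathrm{ed}(x,y)$ is the edit distance: the minimum number of character insertions, deletions and substitutions transforming $x$ into $y$. In the asymmetric streaming model the algorithm has random (query) access to the offline string $\bar{s}$ while the characters of the online string $s$ arrive as a stream. $\tilde{O}$ hides polylogarithmic factors in $n$. *)

theory Defs
  imports Complex_Main "HOL-Library.Log_Nat"
begin

inductive edit_step :: "'a list \<Rightarrow> 'a list \<Rightarrow> bool" where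
  insertion: "edit_step (u @ v) (u @ a # v)"
| deletion: "edit_step (u @ a # v) (u @ v)"
| substitution: "edit_step (u @ a # v) (u @ b # v)"

definition ed :: "'a list \<Rightarrow> 'a list \<Rightarrow> nat" where
  "ed x y = (LEAST k. (edit_step ^^ k) x y)"

text \<open>
  The asymmetric streaming model, as a deterministic random access machine with structured
  control. Working memory consists of arrays of natural numbers, all cells initially zero except
  those holding an input; \<open>M a i\<close> is cell \<open>i\<close> of array \<open>a\<close>, and cell 0 of an array serves as a
  scalar variable. Characters are natural numbers.

  The two strings live outside the working memory. The offline string may be queried at any
  position any number of times, and its length is known. The online string can only be accessed
  by consuming its next character, so every computation makes a single pass over it.
\<close>

type_synonym store = "nat \<Rightarrow> nat \<Rightarrow> nat"

datatype expr =
    Lit nat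
  | Cell nat expr
  | OfflineLength
  | Plus expr expr
  | Minus expr expr
  | Times expr expr
  | Div expr expr
  | Less expr expr

fun eval :: "nat \<Rightarrow> store \<Rightarrow> expr \<Rightarrow> nat" where
  "eval n M (Lit c) = c"
| "eval n M (Cell a e) = M a (eval n M e)"
| "eval n M OfflineLength = n"
| "eval n M (Plus e f) = eval n M e + eval n M f"
| "eval n M (Minus e f) = eval n M e - eval n M f"
| "eval n M (Times e f) = eval n M e * eval n M f"
| "eval n M (Div e f) = eval n M e div eval n M f"
| "eval n M (Less e f) = (if eval n M e < eval n M f then 1 else 0)"

text \<open>
  \<open>Assign a i e\<close>, \<open>Query a i e\<close> and \<open>Read a i\<close> write to cell \<open>i\<close> of array \<open>a\<close>: the value of \<open>e\<close>,
  the character of the offline string at position \<open>e\<close>, and the next character of the stream.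
  Tests succeed if the expression is nonzero.
\<close>

datatype prog =
    Skip
  | Assign nat expr expr
  | Query nat expr expr
  | Read nat expr
  | Seq prog prog
  | Cond expr prog prog
  | While expr prog

definition upd :: "store \<Rightarrow> nat \<Rightarrow> nat \<Rightarrow> nat \<Rightarrow> store" where
  "upd M a i v = M(a := (M a)(i := v))"

text \<open>
  Number of bits of the working memory: the store is represented by its nonzero cells, each of
  which is charged for its address and its content. The set of nonzero cells is finite
  throughout every computation, see \<open>exec_finite\<close> below.
\<close>

definition space :: "store \<Rightarrow> nat" where
  "space M = (\<Sum>(a, i) \<in> {(a, i). M a i \<noteq> 0}.
     1 + floorlog 2 a + floorlog 2 i + floorlog 2 (M a i))"

text \<open>
  \<open>exec t P M s M' s' m\<close>: with offline string \<open>t\<close>, store \<open>M\<close> and remaining stream \<open>s\<close>, the program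
  \<open>P\<close> terminates in store \<open>M'\<close> with remaining stream \<open>s'\<close>, and \<open>m\<close> is the maximum of \<open>space\<close> over
  all stores occurring on the way. Queries outside the offline string and reading from an
  exhausted stream get stuck.
\<close>

inductive exec ::
  "nat list \<Rightarrow> prog \<Rightarrow> store \<Rightarrow> nat list \<Rightarrow> store \<Rightarrow> nat list \<Rightarrow> nat \<Rightarrow> bool" for t where
  Skip: "exec t Skip M s M s (space M)"
| Assign: "M' = upd M a (eval (length t) M i) (eval (length t) M e) \<Longrightarrow>
    exec t (Assign a i e) M s M' s (max (space M) (space M'))"
| Query: "p = eval (length t) M e \<Longrightarrow> p < length t \<Longrightarrow>
    M' = upd M a (eval (length t) M i) (t ! p) \<Longrightarrow>
    exec t (Query a i e) M s M' s (max (space M) (space M'))"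
| Read: "M' = upd M a (eval (length t) M i) c \<Longrightarrow>
    exec t (Read a i) M (c # s) M' s (max (space M) (space M'))"
| Seq: "exec t P M s M' s' m \<Longrightarrow> exec t Q M' s' M'' s'' m' \<Longrightarrow>
    exec t (Seq P Q) M s M'' s'' (max m m')"
| CondTrue: "eval (length t) M e \<noteq> 0 \<Longrightarrow> exec t P M s M' s' m \<Longrightarrow>
    exec t (Cond e P Q) M s M' s' m"
| CondFalse: "eval (length t) M e = 0 \<Longrightarrow> exec t Q M s M' s' m \<Longrightarrow>
    exec t (Cond e P Q) M s M' s' m"
| WhileTrue: "eval (length t) M e \<noteq> 0 \<Longrightarrow> exec t P M s M' s' m \<Longrightarrow>
    exec t (While e P) M' s' M'' s'' m' \<Longrightarrow>
    exec t (While e P) M s M'' s'' (max m m')"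
| WhileFalse: "eval (length t) M e = 0 \<Longrightarrow> exec t (While e P) M s M s (space M)"

inductive_cases exec_SkipE: "exec t Skip M s M' s' m"
inductive_cases exec_AssignE: "exec t (Assign a i e) M s M' s' m"
inductive_cases exec_QueryE: "exec t (Query a i e) M s M' s' m"
inductive_cases exec_ReadE: "exec t (Read a i) M s M' s' m"
inductive_cases exec_SeqE: "exec t (Seq P Q) M s M' s' m"
inductive_cases exec_CondE: "exec t (Cond e P Q) M s M' s' m"
inductive_cases exec_WhileE: "exec t (While e P) M s M' s' m"

lemma exec_deterministic:
  "exec t P M s M1 s1 m1 \<Longrightarrow> exec t P M s M2 s2 m2 \<Longrightarrow> M2 = M1 \<and> s2 = s1 \<and> m2 = m1"
proof (induction arbitrary: M2 s2 m2 rule: exec.induct)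
  case (Skip M s)
  then show ?case by (auto elim: exec_SkipE)
next
  case (Assign M' M a i e s)
  then show ?case by (auto elim: exec_AssignE)
next
  case (Query p M e M' a i s)
  then show ?case by (auto elim: exec_QueryE)
next
  case (Read M' M a i c s)
  then show ?case by (auto elim: exec_ReadE)
next
  case (Seq P M s M' s' m Q M'' s'' m')
  from Seq.prems show ?case by (rule exec_SeqE) (use Seq.IH in blast)
next
  case (CondTrue M e P s M' s' m Q)
  from CondTrue.prems show ?case by (rule exec_CondE) (use CondTrue.hyps(1) CondTrue.IH in \<open>simp | blast\<close>)+
next
  case (CondFalse M e Q s M' s' m P)
  from CondFalse.prems show ?case by (rule exec_CondE) (use CondFalse.hyps(1) CondFalse.IH in \<open>simp | blast\<close>)+
next
  case (WhileTrue M e P s M' s' m M'' s'' m')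
  from WhileTrue.prems show ?case by (rule exec_WhileE) (use WhileTrue.hyps(1) WhileTrue.IH in \<open>simp | blast\<close>)+
next
  case (WhileFalse M e P s)
  from WhileFalse.prems show ?case by (rule exec_WhileE) (use WhileFalse.hyps(1) in \<open>simp | blast\<close>)+
qed

lemma finite_upd:
  assumes "finite {(a, i). M a i \<noteq> 0}"
  shows "finite {(a, i). upd M b j v a i \<noteq> 0}"
proof (rule finite_subset)
  show "{(a, i). upd M b j v a i \<noteq> 0} \<subseteq> insert (b, j) {(a, i). M a i \<noteq> 0}"
    by (auto simp: upd_def split: if_splits)
qed (use assms in simp)

lemma exec_finite:
  "exec t P M s M' s' m \<Longrightarrow> finite {(a, i). M a i \<noteq> 0} \<Longrightarrow> finite {(a, i). M' a i \<noteq> 0}"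
  by (induction rule: exec.induct) (simp_all only: finite_upd)

text \<open>
  Running \<open>P\<close> on parameter \<open>q\<close>, offline string \<open>t\<close> and online string \<open>s\<close> yields \<open>D\<close> using \<open>m\<close> bits
  of working memory. The parameter is supplied, and the result delivered, in cell 0 of array 0.
\<close>

definition computes :: "prog \<Rightarrow> nat \<Rightarrow> nat list \<Rightarrow> nat list \<Rightarrow> nat \<Rightarrow> nat \<Rightarrow> bool" where
  "computes P q t s D m \<longleftrightarrow>
     (\<exists>M' s'. exec t P (upd (\<lambda>_ _. 0) 0 0 q) s M' s' m \<and> D = M' 0 0)"

end

theory Submission
  imports Defs
begin

text \<open>
  Cut the online string into blocks of length \<open>b = \<lceil>\<surd>n\<rceil>\<close>. Given the row \<open>j \<mapsto> ed (s[1..i]) (t[1..j])\<close>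
  of the dynamic programming table at the start of a block, the row at its end is computed by
  sweeping over the offline string while keeping a single table column of length \<open>b + 1\<close>. Rows are
  too long to be stored, but they are 1-Lipschitz, so a row is stored only at sample positions,
  where \<open>j\<close> becomes a sample once its distance from the last sample exceeds \<open>\<bar>i - j\<bar> / K\<close>. There
  are \<open>O(K log n)\<close> samples. Interpolating from them costs an error of at most \<open>2 \<bar>i - j\<bar> / K\<close>, and
  \<open>\<bar>i - j\<bar>\<close> is at most half of the cost of any alignment of the full strings through \<open>(i, j)\<close>. Hence
  each block contributes a factor \<open>1 + 1 / K\<close>, and \<open>K = q b\<close> with \<open>q \<approx> 2 / \<epsilon>\<close> suffices.
\<close>

subsection \<open>Edit distance by dynamic programming\<close>

fun lev :: "'a list \<Rightarrow> 'a list \<Rightarrow> nat" where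
  "lev [] ys = length ys"
| "lev (x # xs) [] = Suc (length xs)"
| "lev (x # xs) (y # ys) =
     min (Suc (lev xs (y # ys))) (min (Suc (lev (x # xs) ys)) (lev xs ys + of_bool (x \<noteq> y)))"

lemma lev_Nil2 [simp]: "lev xs [] = length xs"
  by (cases xs) auto

lemma lev_self: "lev xs xs = 0"
  by (induction xs) auto

lemma lev_sym: "lev xs ys = lev ys xs"
  by (induction xs ys rule: lev.induct) auto

lemma lev_Cons_le: "lev (x # xs) ys \<le> Suc (lev xs ys)"
  by (cases ys) auto

lemma lev_Cons_le2: "lev xs (y # ys) \<le> Suc (lev xs ys)"
  by (metis lev_Cons_le lev_sym)

lemma lev_le_Cons: "lev xs ys \<le> Suc (lev (x # xs) ys)"
proof (induction ys)
  case (Cons y ys)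
  then show ?case
    using lev_Cons_le2[of xs y ys] by (auto simp: min_def)
qed auto

lemma lev_subst_le: "lev (x # xs) ys \<le> Suc (lev (y # xs) ys)"
proof (induction ys)
  case (Cons z zs)
  then show ?case by (auto simp: min_def)
qed auto

text \<open>The premise ranges over all \<open>zs\<close> because the recursion shortens the target
  as well, so its suffixes occur too.\<close>

lemma lev_context:
  assumes "\<And>zs. lev xs zs \<le> Suc (lev ys zs)"
  shows "lev (a # xs) zs \<le> Suc (lev (a # ys) zs)"
proof (induction zs)
  case Nil
  then show ?case using assms[of "[]"] by simp
next
  case (Cons z zs)
  then show ?case using assms[of zs] assms[of "z # zs"] by (auto simp: min_def)
qed

lemma lev_context_append:
  assumes "\<And>zs. lev xs zs \<le> Suc (lev ys zs)"
  shows "lev (us @ xs) zs \<le> Suc (lev (us @ ys) zs)"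
  using assms by (induction us arbitrary: zs) (auto intro: lev_context)

text \<open>The context lemma moves the edited position to the head, where the one-character
  inequalities apply. This is the triangle inequality for a single step; chaining it bounds
  \<open>lev\<close> by the length of every edit sequence.\<close>

lemma lev_edit_step:
  assumes "edit_step xs ys"
  shows "lev xs zs \<le> Suc (lev ys zs)"
  using assms
proof cases
  case (insertion u v a)
  then show ?thesis using lev_context_append[OF lev_le_Cons] by auto
next
  case (deletion u a v)
  then show ?thesis using lev_context_append[OF lev_Cons_le] by auto
next
  case (substitution u a v b)
  then show ?thesis using lev_context_append[OF lev_subst_le] by auto
qed

lemma lev_le_edit_steps: "(edit_step ^^ k) xs ys \<Longrightarrow> lev xs ys \<le> k"
proof (induction k arbitrary: xs)
  case 0
  then show ?case by (simp add: lev_self)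
next
  case (Suc k)
  then obtain zs where "edit_step xs zs" "(edit_step ^^ k) zs ys"
    by (blast dest: relpowp_Suc_D2)
  then show ?case using Suc.IH lev_edit_step[of xs zs ys] by fastforce
qed

lemma edit_step_Cons: "edit_step xs ys \<Longrightarrow> edit_step (a # xs) (a # ys)"
  by (erule edit_step.cases; clarify)
    (metis append_Cons edit_step.intros)+

lemma edit_steps_Cons: "(edit_step ^^ k) xs ys \<Longrightarrow> (edit_step ^^ k) (a # xs) (a # ys)"
proof (induction k arbitrary: ys)
  case (Suc k)
  then show ?case by (auto intro: edit_step_Cons)
qed simp

lemma edit_step_ins: "edit_step xs (a # xs)"
  using edit_step.insertion[of "[]"] by simp

lemma edit_step_del: "edit_step (a # xs) xs"
  using edit_step.deletion[of "[]"] by simp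

lemma edit_step_subst: "edit_step (a # xs) (b # xs)"
  using edit_step.substitution[of "[]"] by simp

text \<open>Each branch of the minimum supplies one step of an optimal sequence: a deletion is
  carried out first, an insertion or a substitution of the first character last.\<close>

lemma edit_steps_lev: "(edit_step ^^ lev xs ys) xs ys"
proof (induction xs ys rule: lev.induct)
  case (1 ys)
  show ?case
  proof (induction ys)
    case (Cons y ys)
    then show ?case using relpowp_Suc_I[OF Cons edit_step_ins] by simp
  qed simp
next
  case (2 x xs)
  have *: "(edit_step ^^ length xs) xs []"
  proof (induction xs)
    case (Cons y ys)
    then show ?case using relpowp_Suc_I2[OF edit_step_del Cons] by simp
  qed simp
  show ?case using relpowp_Suc_I2[OF edit_step_del *] by simp
next
  case (3 x xs y ys)
  consider "lev (x # xs) (y # ys) = Suc (lev xs (y # ys))"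
    | "lev (x # xs) (y # ys) = Suc (lev (x # xs) ys)"
    | "lev (x # xs) (y # ys) = lev xs ys + of_bool (x \<noteq> y)"
    unfolding lev.simps min_def by metis
  then show ?case
  proof cases
    case 1
    then show ?thesis
      using relpowp_Suc_I2[OF edit_step_del "3.IH"(1)] by simp
  next
    case 2
    then show ?thesis
      using relpowp_Suc_I[OF "3.IH"(2) edit_step_ins] by simp
  next
    case 3
    then show ?thesis
      using edit_steps_Cons[OF "3.IH"(3)] relpowp_Suc_I[OF edit_steps_Cons[OF "3.IH"(3)] edit_step_subst]
      by (cases "x = y") auto
  qed
qed

lemma ed_eq_lev: "ed xs ys = lev xs ys"
  unfolding ed_def by (rule Least_equality) (auto intro: edit_steps_lev lev_le_edit_steps)

lemma edit_step_rev: "edit_step xs ys \<Longrightarrow> edit_step (rev xs) (rev ys)"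
  by (erule edit_step.cases; clarify) (simp_all add: edit_step.intros)

lemma edit_steps_rev: "(edit_step ^^ k) xs ys \<Longrightarrow> (edit_step ^^ k) (rev xs) (rev ys)"
proof (induction k arbitrary: ys)
  case (Suc k)
  then show ?case by (auto intro: edit_step_rev)
qed simp

text \<open>\<open>lev\<close> peels off first characters, the table below peels off last characters
  of prefixes; reversal connects the two.\<close>

lemma ed_rev: "ed (rev xs) (rev ys) = ed xs ys"
proof -
  have "(edit_step ^^ k) (rev xs) (rev ys) \<longleftrightarrow> (edit_step ^^ k) xs ys" for k
    using edit_steps_rev[of k xs ys] edit_steps_rev[of k "rev xs" "rev ys"] by auto
  then show ?thesis by (simp add: ed_def)
qed

section \<open>The dynamic programming table and the Lipschitz property of its rows\<close>

text \<open>
  The table is started from an arbitrary row \<open>F\<close>, so that the rows of one block can be computed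
  from an approximation of the row preceding the block.
\<close>

fun edit_table :: "(nat \<Rightarrow> 'a) \<Rightarrow> (nat \<Rightarrow> 'a) \<Rightarrow> (nat \<Rightarrow> nat) \<Rightarrow> nat \<Rightarrow> nat \<Rightarrow> nat" where
  "edit_table c d F 0 j = F j"
| "edit_table c d F (Suc i) 0 = Suc (edit_table c d F i 0)"
| "edit_table c d F (Suc i) (Suc j) =
     min (min (Suc (edit_table c d F i (Suc j))) (Suc (edit_table c d F (Suc i) j)))
         (edit_table c d F i j + of_bool (c i \<noteq> d j))"

lemma edit_table_eq_ed:
  assumes "i \<le> length s" "j \<le> length t"
  shows "edit_table ((!) s) ((!) t) (\<lambda>j. j) i j = ed (take i s) (take j t)"
proof -
  have "edit_table ((!) s) ((!) t) (\<lambda>j. j) i j = lev (rev (take i s)) (rev (take j t))"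
    using assms
  proof (induction "(!) s" "(!) t" "\<lambda>j :: nat. j" i j rule: edit_table.induct)
    case (3 i j)
    then show ?case by (simp add: take_Suc_conv_app_nth)
  qed (auto simp: take_Suc_conv_app_nth)
  then show ?thesis by (metis ed_eq_lev ed_rev)
qed

text \<open>Later rows depend on the earlier ones only through row \<open>i\<close>, so the table
  can be restarted from it block by block. The inner induction on \<open>j\<close> is there because
  an entry also depends on its left neighbour.\<close>

lemma edit_table_add:
  "edit_table c d F (i + k) j = edit_table (\<lambda>k. c (i + k)) d (edit_table c d F i) k j"
proof (induction k arbitrary: j)
  case (Suc k)
  show ?case by (induction j) (simp_all add: Suc.IH)
qed simp

lemma edit_table_mono:
  assumes F: "\<And>j. F j \<le> G j"
  shows "edit_table c d F i j \<le> edit_table c d G i j"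
proof (induction i arbitrary: j)
  case IH: (Suc i)
  show ?case
  proof (induction j)
    case (Suc j)
    then show ?case using IH[of j] IH[of "Suc j"] by (auto simp: min_def)
  qed (use IH in simp)
qed (use F in simp)

lemma edit_table_le: "(\<And>j. F j \<le> i0 + j) \<Longrightarrow> edit_table c d F i j \<le> i0 + i + j"
proof (induction c d F i j rule: edit_table.induct)
  case (3 c d F i j)
  then show ?case by (simp add: min_le_iff_disj)
qed (fastforce)+

lemma edit_table_step_right:
  "edit_table c d (\<lambda>j. j) i (Suc j) \<le> Suc (edit_table c d (\<lambda>j. j) i j)"
  by (cases i) auto

text \<open>Going down one row in column \<open>j\<close> costs at most one. This settles the
  diagonal branch of the minimum at once and the vertical one through the induction hypothesis; the
  horizontal branch is immediate.\<close>

lemma edit_table_step_left: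
  "edit_table c d (\<lambda>j. j) i j \<le> Suc (edit_table c d (\<lambda>j. j) i (Suc j))"
proof (induction i)
  case (Suc i)
  have "edit_table c d (\<lambda>j. j) (Suc i) j \<le> Suc (edit_table c d (\<lambda>j. j) i j)"
    by (cases j) auto
  then show ?case using Suc by (auto simp: min_def)
qed simp

lemma edit_table_lipschitz:
  "edit_table c d (\<lambda>j. j) i (j + k) \<le> edit_table c d (\<lambda>j. j) i j + k"
  "edit_table c d (\<lambda>j. j) i j \<le> edit_table c d (\<lambda>j. j) i (j + k) + k"
proof (induction k)
  case (Suc k)
  {
    case 1
    then show ?case using Suc.IH(1) edit_table_step_right[of c d i "j + k"] by simp
  next
    case 2
    then show ?case using Suc.IH(2) edit_table_step_left[of c d i "j + k"] by simp
  }
qed auto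

text \<open>Truncated subtraction makes \<open>gap i j\<close> the distance of \<open>i\<close> and \<open>j\<close>.\<close>

abbreviation gap :: "nat \<Rightarrow> nat \<Rightarrow> nat" where
  "gap i j \<equiv> (i - j) + (j - i)"

text \<open>Only insertions and deletions leave a diagonal, each by one and at cost one.\<close>

lemma gap_le_edit_table: "gap i j \<le> edit_table c d (\<lambda>j. j) i j"
proof (induction c d "\<lambda>j :: nat. j" i j rule: edit_table.induct)
  case (3 c d i j)
  then show ?case by auto
qed auto

subsection \<open>Sampling a row\<close>

text \<open>Sample positions depend on \<open>K\<close> and \<open>i\<close> alone, so a scan from
  left to right can recompute them and only the sampled values need memory. The product avoids a
  division, and the strict comparison leaves 0 as the only sample if \<open>K = 0\<close>.\<close>

fun last_sample :: "nat \<Rightarrow> nat \<Rightarrow> nat \<Rightarrow> nat" where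
  "last_sample K i 0 = 0"
| "last_sample K i (Suc j) =
     (if gap i (Suc j) < K * (Suc j - last_sample K i j) then Suc j else last_sample K i j)"

fun sample_index :: "nat \<Rightarrow> nat \<Rightarrow> nat \<Rightarrow> nat" where
  "sample_index K i 0 = 0"
| "sample_index K i (Suc j) =
     (if gap i (Suc j) < K * (Suc j - last_sample K i j)
      then Suc (sample_index K i j) else sample_index K i j)"

text \<open>Slope one is the fastest growth of an exact row, so interpolating values that lie above
  an exact row never falls below it.\<close>

definition interpolate :: "nat \<Rightarrow> nat \<Rightarrow> (nat \<Rightarrow> nat) \<Rightarrow> nat \<Rightarrow> nat" where
  "interpolate K i A j = A (last_sample K i j) + (j - last_sample K i j)"

lemma last_sample_le: "last_sample K i j \<le> j"
  by (induction j) (auto simp: le_SucI)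

lemma last_sample_dist: "K * (j - last_sample K i j) \<le> gap i j"
  by (induction j) auto

lemma sample_index_mono: "j \<le> j' \<Longrightarrow> sample_index K i j \<le> sample_index K i j'"
  by (rule lift_Suc_mono_le) auto

lemma sample_index_le_self: "sample_index K i j \<le> j"
  by (induction j) auto

text \<open>The index grows in unit steps. Hence every stored cell belongs to some position, which
  later bounds the contents of all cells that are copied.\<close>

lemma sample_index_onto: "k \<le> sample_index K i n \<Longrightarrow> \<exists>j\<le>n. sample_index K i j = k"
proof (induction n)
  case (Suc n)
  then show ?case by (cases "k \<le> sample_index K i n") (auto simp: le_Suc_eq split: if_splits)
qed simp

lemma last_sample_0 [simp]: "last_sample 0 i j = 0"
  by (induction j) auto

lemma sample_index_0 [simp]: "sample_index 0 i j = 0"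
  by (induction j) auto

lemma interpolate_le:
  assumes "\<And>j. A j \<le> i + j"
  shows "interpolate K i A j \<le> i + j"
  using assms[of "last_sample K i j"] last_sample_le[of K i j] by (simp add: interpolate_def)

section \<open>Counting the samples of a row\<close>

lemma harmonic_le: "(\<Sum>m\<le>n. 1 / (real m + 1)) \<le> 1 + ln (real n + 1)"
proof (induction n)
  case (Suc n)
  have "ln ((real n + 1) / (real n + 2)) \<le> (real n + 1) / (real n + 2) - 1"
    by (intro ln_le_minus_one) auto
  also have "\<dots> = - 1 / (real n + 2)" by (simp add: field_simps)
  finally have "ln (real n + 2) - ln (real n + 1) \<ge> 1 / (real n + 2)"
    by (simp add: ln_div)
  then show ?case using Suc by (simp add: add.commute)
qed simp

text \<open>Every distance from \<open>i\<close> occurs at most once on each side of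
  \<open>i\<close>, so two harmonic sums dominate. Position \<open>i\<close> itself is counted on
  both sides, which only enlarges the bound.\<close>

lemma gap_sum_le:
  assumes "i \<le> n"
  shows "(\<Sum>j\<le>n. 1 / (real (gap i j) + 1)) \<le> 2 * (1 + ln (real n + 1))"
proof -
  define f where "f j = 1 / (real (gap i j) + 1)" for j
  define h where "h m = 1 / (real m + 1)" for m :: nat
  have "sum f {..n} + sum f ({..i} \<inter> {i..n}) = sum f {..i} + sum f {i..n}"
  proof -
    have "{..n} = {..i} \<union> {i..n}" using assms by auto
    then show ?thesis using sum.union_inter[of "{..i}" "{i..n}" f] by simp
  qed
  moreover have "0 \<le> sum f ({..i} \<inter> {i..n})"
    by (rule sum_nonneg) (simp add: f_def)
  moreover have "sum f {..i} = sum h {..i}"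
    by (rule sum.reindex_bij_witness[of _ "\<lambda>m. i - m" "\<lambda>m. i - m"]) (auto simp: f_def h_def)
  moreover have "sum h {..i} \<le> sum h {..n}"
    using assms by (intro sum_mono2) (auto simp: h_def)
  moreover have "sum f {i..n} = sum h {..n - i}"
    by (rule sum.reindex_bij_witness[of _ "\<lambda>m. i + m" "\<lambda>j. j - i"])
      (use assms in \<open>auto simp: f_def h_def\<close>)
  moreover have "sum h {..n - i} \<le> sum h {..n}"
    by (intro sum_mono2) (auto simp: h_def)
  moreover have "sum h {..n} \<le> 1 + ln (real n + 1)"
    unfolding h_def by (rule harmonic_le)
  ultimately have "sum f {..n} \<le> 2 * (1 + ln (real n + 1))"
    by argo
  then show ?thesis by (simp only: f_def[abs_def])
qed

text \<open>
  If \<open>p\<close> and \<open>p'\<close> are consecutive samples, then \<open>gap i j < (K + 1) * (p' - p)\<close> for all \<open>j\<close> with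
  \<open>p < j \<le> p'\<close>, so these \<open>j\<close> contribute at least 1 to the sum.
\<close>

lemma sample_index_le_sum:
  "real (sample_index K i j)
     \<le> (\<Sum>l\<in>{1..last_sample K i j}. (real K + 1) / (real (gap i l) + 1))"
proof (induction j)
  case (Suc j)
  define p where "p = last_sample K i j"
  have p: "p \<le> j" by (simp add: p_def last_sample_le)
  show ?case
  proof (cases "gap i (Suc j) < K * (Suc j - p)")
    case True
    define g where "g = Suc j - p"
    have g: "g > 0" using p by (simp add: g_def)
    have "1 = (\<Sum>l\<in>{p<..Suc j}. 1 / real g)"
      using g by (simp add: g_def)
    also have "\<dots> \<le> (\<Sum>l\<in>{p<..Suc j}. (real K + 1) / (real (gap i l) + 1))"
    proof (rule sum_mono)
      fix l assume l: "l \<in> {p<..Suc j}"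
      define x where "x = gap i l"
      define y where "y = gap i (Suc j)"
      define z where "z = K * g"
      \<comment> \<open>The gap is 1-Lipschitz, which carries the sampling condition at
        \<open>Suc j\<close> over to every \<open>l\<close> since the previous sample.\<close>
      have "x \<le> y + (Suc j - l)" using l by (auto simp: x_def y_def)
      moreover have "y < z" "Suc j - l < g"
        using True l by (auto simp: g_def y_def z_def)
      ultimately have "x + 1 \<le> z + g" by linarith
      then have "real (x + 1) \<le> real (K * g + g)" unfolding z_def by (simp only: of_nat_le_iff)
      then have "real x + 1 \<le> (real K + 1) * real g" by (simp add: algebra_simps)
      then show "1 / real g \<le> (real K + 1) / (real (gap i l) + 1)"
        using g unfolding x_def[symmetric] by (simp add: field_simps)
    qed
    finally have "1 \<le> (\<Sum>l\<in>{p<..Suc j}. (real K + 1) / (real (gap i l) + 1))" .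
    moreover have "{1..Suc j} = {1..p} \<union> {p<..Suc j}" using p by auto
    moreover have "sum g ({1..p} \<union> {p<..Suc j}) = sum g {1..p} + sum g {p<..Suc j}" for g :: "nat \<Rightarrow> real"
      by (rule sum.union_disjoint) auto
    ultimately show ?thesis using Suc True
      by (simp add: p_def[symmetric] del: sum.cl_ivl_Suc)
  next
    case False
    then show ?thesis using Suc by (simp add: p_def)
  qed
qed simp

lemma sample_index_le:
  assumes "i \<le> n"
  shows "real (sample_index K i n) \<le> 2 * (real K + 1) * (1 + ln (real n + 1))"
proof -
  have "real (sample_index K i n) \<le> (\<Sum>l\<in>{1..last_sample K i n}. (real K + 1) / (real (gap i l) + 1))"
    by (rule sample_index_le_sum)
  also have "\<dots> \<le> (\<Sum>l\<le>n. (real K + 1) / (real (gap i l) + 1))"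
    using last_sample_le[of K i n] by (intro sum_mono2) auto
  also have "\<dots> = (real K + 1) * (\<Sum>l\<le>n. 1 / (real (gap i l) + 1))"
    by (simp add: sum_distrib_left)
  also have "\<dots> \<le> (real K + 1) * (2 * (1 + ln (real n + 1)))"
    using gap_sum_le[OF assms] by (intro mult_left_mono) auto
  finally show ?thesis by (simp only: mult_ac)
qed

section \<open>Propagation of the error through exact rows and through sampling\<close>

text \<open>
  Errors are measured relative to \<open>edit_table c d (\<lambda>j. j) i j + gap i j\<close>, which never decreases
  along an optimal alignment and equals the edit distance at its end.
\<close>

definition approx_row :: "(nat \<Rightarrow> 'a) \<Rightarrow> (nat \<Rightarrow> 'a) \<Rightarrow> real \<Rightarrow> nat \<Rightarrow> (nat \<Rightarrow> nat) \<Rightarrow> bool" where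
  "approx_row c d e i F \<longleftrightarrow> (\<forall>j. F j \<le> i + j \<and> edit_table c d (\<lambda>j. j) i j \<le> F j \<and>
     real (F j) \<le> real (edit_table c d (\<lambda>j. j) i j) + e * real (edit_table c d (\<lambda>j. j) i j + gap i j))"

lemma approx_row_bound: "approx_row c d e i F \<Longrightarrow> F j \<le> i + j"
  by (simp add: approx_row_def)

lemma approx_row_0: "approx_row c d 0 0 (\<lambda>j. j)"
  by (simp add: approx_row_def)

text \<open>Exact table steps do not increase the error rate \<open>e\<close>: along the branch
  attaining the exact minimum, the value plus the gap does not decrease, so the slack of the
  predecessor still fits.\<close>

lemma approx_row_edit_table:
  assumes "approx_row c d e i F" and e: "e \<ge> 0"
  shows "approx_row c d e (i + k) (edit_table (\<lambda>k. c (i + k)) d F k)"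
proof -
  let ?D = "edit_table c d (\<lambda>j. j)"
  let ?T = "edit_table (\<lambda>k. c (i + k)) d F"
  have F: "F j \<le> i + j" "?D i j \<le> F j" "real (F j) \<le> real (?D i j) + e * real (?D i j + gap i j)" for j
    using assms by (auto simp: approx_row_def)
  have "?T k j \<le> i + k + j" for j
    using F by (intro edit_table_le) auto
  moreover have "?D (i + k) j \<le> ?T k j" for j
    unfolding edit_table_add using F by (intro edit_table_mono) auto
  moreover have "real (?T k j) \<le> real (?D (i + k) j) + e * real (?D (i + k) j + gap (i + k) j)" for j
  proof (induction k arbitrary: j)
    case 0
    then show ?case using F by simp
  next
    case IH: (Suc k)
    \<comment> \<open>\<open>T'\<close>, \<open>D'\<close> and \<open>g\<close> are approximate
      value, exact value and gap at the predecessor, and \<open>a\<close> is the cost of the edge.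
      An edge of cost \<open>a\<close> changes the gap by at most \<open>a\<close>.\<close>
    have step: "real (?T (Suc k) j) \<le> real (?D (i + Suc k) j) + e * real (?D (i + Suc k) j + gap (i + Suc k) j)"
      if "real (T') \<le> real D' + e * real (D' + g)" "?T (Suc k) j \<le> T' + a"
        "?D (i + Suc k) j = D' + a" "g \<le> gap (i + Suc k) j + a" for T' D' g a j
    proof -
      have "e * real (D' + g) \<le> e * real (?D (i + Suc k) j + gap (i + Suc k) j)"
        using that e by (intro mult_left_mono) auto
      then show ?thesis using that by simp
    qed
    show ?case
    proof (induction j)
      case 0
      show ?case by (rule step[OF IH[of 0], of _ 1]) auto
    next
      case (Suc j)
      \<comment> \<open>The exact table selects the branch. The approximate table is a minimum over
        the same branches, so following this one bounds it from above.\<close>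
      consider "?D (i + Suc k) (Suc j) = ?D (i + k) (Suc j) + 1"
        | "?D (i + Suc k) (Suc j) = ?D (i + Suc k) j + 1"
        | "?D (i + Suc k) (Suc j) = ?D (i + k) j + of_bool (c (i + k) \<noteq> d j)"
        unfolding add_Suc_right edit_table.simps min_def by (metis Suc_eq_plus1)
      then show ?case
      proof cases
        case 1
        show ?thesis by (rule step[OF IH[of "Suc j"] _ 1]) auto
      next
        case 2
        show ?thesis by (rule step[OF Suc _ 2]) auto
      next
        case 3
        show ?thesis by (rule step[OF IH[of j] _ 3]) auto
      qed
    qed
  qed
  ultimately show ?thesis by (simp add: approx_row_def)
qed

text \<open>With \<open>x\<close> the distance of \<open>j\<close> from its last sample, falling
  back to the sample and returning costs \<open>2 * x\<close> in value, and the allowance at the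
  sample is larger by at most \<open>e * 2 * x\<close>. Sampling makes \<open>2 * x\<close> at most
  a fraction \<open>1 / K\<close> of value plus gap.\<close>

lemma approx_row_interpolate:
  assumes "approx_row c d e i A" and e: "e \<ge> 0" and K: "K > 0"
  shows "approx_row c d ((1 + e) * (1 + 1 / real K) - 1) i (interpolate K i A)"
proof -
  let ?D = "edit_table c d (\<lambda>j. j)"
  have A: "A j \<le> i + j" "?D i j \<le> A j" "real (A j) \<le> real (?D i j) + e * real (?D i j + gap i j)" for j
    using assms by (auto simp: approx_row_def)
  have "?D i j \<le> interpolate K i A j \<and> real (interpolate K i A j) \<le> real (?D i j)
      + ((1 + e) * (1 + 1 / real K) - 1) * real (?D i j + gap i j)" for j
  proof -
    define p where "p = last_sample K i j"
    obtain x where j: "j = p + x"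
      using last_sample_le[of K i j] unfolding p_def by (metis le_Suc_ex)
    have x: "K * x \<le> gap i j"
      using last_sample_dist[of K j i] j unfolding p_def by (metis add_diff_cancel_left')
    have I: "interpolate K i A j = A p + x"
      by (simp add: interpolate_def p_def[symmetric]) (simp add: j)
    have "?D i j \<le> interpolate K i A j"
      using edit_table_lipschitz(1)[of c d i p x] A(2)[of p] I j by simp
    moreover have "real (interpolate K i A j) \<le> real (?D i j)
      + ((1 + e) * (1 + 1 / real K) - 1) * real (?D i j + gap i j)"
    proof -
      have D: "?D i p \<le> ?D i j + x"
        using edit_table_lipschitz(2)[of c d i p x] j by simp
      have g: "gap i p \<le> gap i j + x" using j by auto
      let ?V = "real (?D i j + gap i j)"
      \<comment> \<open>The sampling rule bounds \<open>K * x\<close> by the gap, and the gap is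
        also at most the table value. Adding both bounds gives the factor 2.\<close>
      have V: "2 * real x \<le> ?V / real K"
      proof -
        have "2 * (K * x) \<le> ?D i j + gap i j"
          using x gap_le_edit_table[of i j c d] by simp
        then have "real (2 * (K * x)) \<le> ?V" by (simp only: of_nat_le_iff)
        then show ?thesis using K by (simp add: field_simps)
      qed
      have "real (interpolate K i A j) \<le> real (?D i p) + e * real (?D i p + gap i p) + x"
        using I A(3)[of p] by simp
      also have "\<dots> \<le> real (?D i j) + x + e * (?V + 2 * real x) + x"
        using D g e by (intro add_mono mult_left_mono) (auto simp flip: of_nat_add)
      also have "\<dots> = real (?D i j) + e * ?V + (1 + e) * (2 * real x)"
        by (simp add: algebra_simps)
      also have "\<dots> \<le> real (?D i j) + e * ?V + (1 + e) * (?V / real K)"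
        using V e by (intro add_left_mono mult_left_mono) auto
      also have "\<dots> = real (?D i j) + ((1 + e) * (1 + 1 / real K) - 1) * ?V"
        by (simp add: algebra_simps add_divide_distrib)
      finally show ?thesis .
    qed
    ultimately show ?thesis by blast
  qed
  then show ?thesis using interpolate_le[OF A(1)] by (simp add: approx_row_def)
qed

subsection \<open>Weakest preconditions with a memory bound\<close>

lemma upd_apply: "upd M a i v b j = (if b = a \<and> j = i then v else M b j)"
  by (simp add: upd_def)

lemma upd_same [simp]: "upd M a i v a = (M a)(i := v)"
  by (simp add: upd_def)

lemma upd_other [simp]: "b \<noteq> a \<Longrightarrow> upd M a i v b = M b"
  by (simp add: upd_def)

locale bounded_memory =
  fixes t :: "nat list" and arrays cells vals :: nat
begin

text \<open>Confining the nonzero cells to a box reduces the bound on peak memory to a local check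
  at each write.\<close>

definition bounded :: "store \<Rightarrow> bool" where
  "bounded M \<longleftrightarrow> (\<forall>a i. M a i \<noteq> 0 \<longrightarrow> a < arrays \<and> i < cells \<and> M a i < vals)"

definition capacity :: nat where
  "capacity = arrays * cells * (1 + floorlog 2 arrays + floorlog 2 cells + floorlog 2 vals)"

lemma space_le_capacity:
  assumes "bounded M"
  shows "space M \<le> capacity"
proof -
  have sub: "{(a, i). M a i \<noteq> 0} \<subseteq> {..<arrays} \<times> {..<cells}"
    using assms by (auto simp: bounded_def)
  have "space M \<le> (\<Sum>(a, i)\<in>{(a, i). M a i \<noteq> 0}.
      1 + floorlog 2 arrays + floorlog 2 cells + floorlog 2 vals)"
    unfolding space_def
  proof (rule sum_mono)
    fix x assume "x \<in> {(a, i). M a i \<noteq> 0}"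
    then obtain a i where x: "x = (a, i)" "M a i \<noteq> 0" by auto
    then have "a \<le> arrays" "i \<le> cells" "M a i \<le> vals"
      using assms by (auto simp: bounded_def less_imp_le)
    then have "floorlog 2 a \<le> floorlog 2 arrays" "floorlog 2 i \<le> floorlog 2 cells"
      "floorlog 2 (M a i) \<le> floorlog 2 vals"
      by (auto intro: floorlog_mono)
    then show "(case x of (a, i) \<Rightarrow> 1 + floorlog 2 a + floorlog 2 i + floorlog 2 (M a i))
      \<le> (case x of (a, i) \<Rightarrow> 1 + floorlog 2 arrays + floorlog 2 cells + floorlog 2 vals)"
      using x by simp
  qed
  also have "\<dots> = card {(a, i). M a i \<noteq> 0} *
      (1 + floorlog 2 arrays + floorlog 2 cells + floorlog 2 vals)"
    by (simp add: case_prod_unfold)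
  also have "\<dots> \<le> capacity"
    using card_mono[OF _ sub] unfolding capacity_def
    by (intro mult_right_mono) (auto simp: card_cartesian_product)
  finally show ?thesis .
qed

text \<open>Total correctness together with the memory peak. Boundedness of the stores is part of
  the predicate, so invariants of programs need not mention it.\<close>

definition wp :: "prog \<Rightarrow> (store \<Rightarrow> nat list \<Rightarrow> bool) \<Rightarrow> store \<Rightarrow> nat list \<Rightarrow> bool" where
  "wp P Q M s \<longleftrightarrow> (bounded M \<longrightarrow>
     (\<exists>M' s' m. exec t P M s M' s' m \<and> m \<le> capacity \<and> bounded M' \<and> Q M' s'))"

lemma wp_mono:
  assumes "wp P Q M s" "\<And>M' s'. Q M' s' \<Longrightarrow> R M' s'"
  shows "wp P R M s"
  using assms unfolding wp_def by blast

lemma wp_Skip: "Q M s \<Longrightarrow> wp Skip Q M s"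
  unfolding wp_def using exec.Skip space_le_capacity by blast

lemma bounded_upd:
  assumes "bounded M" "a < arrays" "i < cells" "v < vals"
  shows "bounded (upd M a i v)"
  using assms by (auto simp: bounded_def upd_apply)

lemma wp_Assign:
  assumes "a < arrays" "eval (length t) M i < cells" "eval (length t) M e < vals"
    and "Q (upd M a (eval (length t) M i) (eval (length t) M e)) s"
  shows "wp (Assign a i e) Q M s"
  unfolding wp_def using assms exec.Assign[OF refl] bounded_upd space_le_capacity
  by (metis max.bounded_iff)

lemma wp_Query:
  assumes "a < arrays" "eval (length t) M i < cells" "eval (length t) M e < length t"
    and "t ! eval (length t) M e < vals"
    and "Q (upd M a (eval (length t) M i) (t ! eval (length t) M e)) s"
  shows "wp (Query a i e) Q M s"
  unfolding wp_def using assms exec.Query[OF refl _ refl] bounded_upd space_le_capacity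
  by (metis max.bounded_iff)

lemma wp_Read:
  assumes "a < arrays" "eval (length t) M i < cells" "c < vals"
    and "Q (upd M a (eval (length t) M i) c) s"
  shows "wp (Read a i) Q M (c # s)"
  unfolding wp_def using assms exec.Read[OF refl] bounded_upd space_le_capacity
  by (metis max.bounded_iff)

lemma wp_Seq: "wp P (wp P' Q) M s \<Longrightarrow> wp (Seq P P') Q M s"
  unfolding wp_def using exec.Seq by (metis max.bounded_iff)

lemma wp_Cond:
  assumes "eval (length t) M e \<noteq> 0 \<Longrightarrow> wp P Q M s" "eval (length t) M e = 0 \<Longrightarrow> wp P' Q M s"
  shows "wp (Cond e P P') Q M s"
  using assms unfolding wp_def by (cases "eval (length t) M e = 0") (metis exec.CondFalse exec.CondTrue)+

text \<open>The variant \<open>f\<close> provides termination, without which \<open>exec\<close>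
  relates the loop to no result.\<close>

lemma wp_While:
  fixes f :: "store \<Rightarrow> nat"
  assumes "I M s"
    and step: "\<And>M s. I M s \<Longrightarrow> eval (length t) M e \<noteq> 0 \<Longrightarrow> wp P (\<lambda>M' s'. I M' s' \<and> f M' < f M) M s"
    and exit: "\<And>M s. I M s \<Longrightarrow> eval (length t) M e = 0 \<Longrightarrow> Q M s"
  shows "wp (While e P) Q M s"
  using assms(1)
proof (induction "f M" arbitrary: M s rule: less_induct)
  case less
  show ?case
  proof (cases "eval (length t) M e = 0")
    case True
    then show ?thesis
      using exit[OF less.prems] exec.WhileFalse space_le_capacity unfolding wp_def by blast
  next
    case False
    show ?thesis unfolding wp_def
    proof
      assume "bounded M"
      then obtain M' s' m where 1: "exec t P M s M' s' m" "m \<le> capacity" "bounded M'" "I M' s'" "f M' < f M"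
        using step[OF less.prems False] unfolding wp_def by blast
      then obtain M'' s'' m' where "exec t (While e P) M' s' M'' s'' m'" "m' \<le> capacity"
        "bounded M''" "Q M'' s''"
        using less.hyps[of M' s'] unfolding wp_def by blast
      then show "\<exists>M' s' m. exec t (While e P) M s M' s' m \<and> m \<le> capacity \<and> bounded M' \<and> Q M' s'"
        using exec.WhileTrue[OF False 1(1)] 1(2) by (metis max.bounded_iff)
    qed
  qed
qed

end

subsection \<open>The algorithm\<close>

text \<open>
  \<open>vOld\<close> holds the sampled values of a row and \<open>vOldK\<close> the parameter with which it was sampled; the
  sample positions are recomputed while sweeping over the offline string. With \<open>vOldK = 0\<close> the only
  sample is at 0, so the all-zero memory encodes the initial row \<open>\<lambda>j. j\<close>.
\<close>

abbreviation (input) "vParam \<equiv> 0 :: nat"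
abbreviation (input) "vBlockLen \<equiv> 1 :: nat"
abbreviation (input) "vK \<equiv> 2 :: nat"
abbreviation (input) "vOldK \<equiv> 3 :: nat"
abbreviation (input) "vPos \<equiv> 4 :: nat"
abbreviation (input) "vOldPos \<equiv> 5 :: nat"
abbreviation (input) "vLen \<equiv> 6 :: nat"
abbreviation (input) "vBlock \<equiv> 7 :: nat"
abbreviation (input) "vCol \<equiv> 8 :: nat"
abbreviation (input) "vOld \<equiv> 9 :: nat"
abbreviation (input) "vNew \<equiv> 10 :: nat"
abbreviation (input) "vJ \<equiv> 11 :: nat"
abbreviation (input) "vOldIdx \<equiv> 12 :: nat"
abbreviation (input) "vOldLast \<equiv> 13 :: nat"
abbreviation (input) "vNewIdx \<equiv> 14 :: nat"
abbreviation (input) "vNewLast \<equiv> 15 :: nat"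
abbreviation (input) "vI \<equiv> 16 :: nat"
abbreviation (input) "vDiag \<equiv> 17 :: nat"
abbreviation (input) "vChar \<equiv> 18 :: nat"
abbreviation (input) "vTmp \<equiv> 19 :: nat"

abbreviation Var :: "nat \<Rightarrow> expr" where "Var a \<equiv> Cell a (Lit 0)"
abbreviation SetVar :: "nat \<Rightarrow> expr \<Rightarrow> prog" where "SetVar a e \<equiv> Assign a (Lit 0) e"
abbreviation Incr :: "nat \<Rightarrow> prog" where "Incr a \<equiv> SetVar a (Plus (Var a) (Lit 1))"

text \<open>Truncated subtraction turns \<open>e - (e - f)\<close> into the minimum.\<close>

definition Minimum :: "expr \<Rightarrow> expr \<Rightarrow> expr" where "Minimum e f = Minus e (Minus e f)"
definition Neq :: "expr \<Rightarrow> expr \<Rightarrow> expr" where "Neq e f = Plus (Less e f) (Less f e)"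
definition Gap :: "expr \<Rightarrow> expr \<Rightarrow> expr" where "Gap e f = Plus (Minus e f) (Minus f e)"

lemma eval_Minimum [simp]: "eval n M (Minimum e f) = min (eval n M e) (eval n M f)"
  by (simp add: Minimum_def)

lemma eval_Neq [simp]: "eval n M (Neq e f) = of_bool (eval n M e \<noteq> eval n M f)"
  by (auto simp: Neq_def)

lemma eval_Gap [simp]: "eval n M (Gap e f) = gap (eval n M e) (eval n M f)"
  by (simp add: Gap_def)

definition find_block_length :: prog where
  "find_block_length =
     While (Less (Times (Var vBlockLen) (Var vBlockLen)) OfflineLength) (Incr vBlockLen)"

text \<open>The product of two comparisons is their conjunction; the second one cuts the last block
  short.\<close>

definition read_block :: prog where
  "read_block =
     While (Times (Less (Var vLen) (Var vBlockLen)) (Less (Var vPos) OfflineLength))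
       (Seq (Read vBlock (Var vLen)) (Seq (Incr vLen) (Incr vPos)))"

definition init_column :: prog where
  "init_column =
     While (Less (Var vI) (Var vLen))
       (Seq (Assign vCol (Plus (Var vI) (Lit 1)) (Plus (Cell vCol (Var vI)) (Lit 1))) (Incr vI))"

text \<open>One array serves two columns. \<open>vDiag\<close> keeps the entry of the old column
  that was overwritten last, the diagonal neighbour of the next entry.\<close>

definition next_column :: prog where
  "next_column =
     While (Less (Var vI) (Var vLen))
       (Seq (SetVar vTmp (Cell vCol (Plus (Var vI) (Lit 1))))
       (Seq (Assign vCol (Plus (Var vI) (Lit 1))
          (Minimum (Minimum (Plus (Var vTmp) (Lit 1)) (Plus (Cell vCol (Var vI)) (Lit 1)))
               (Plus (Var vDiag) (Neq (Cell vBlock (Var vI)) (Var vChar)))))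
       (Seq (SetVar vDiag (Var vTmp)) (Incr vI))))"

text \<open>The first \<open>Cond\<close> follows the samples of the old row, from which the top
  entry of the new column is interpolated; the last one samples the new row at the bottom entry. The
  old top entry is saved in \<open>vDiag\<close> before it is replaced.\<close>

definition sweep :: prog where
  "sweep =
     While (Less (Var vJ) OfflineLength)
       (Seq (Query vChar (Lit 0) (Var vJ))
       (Seq (Incr vJ)
       (Seq (Cond (Less (Gap (Var vOldPos) (Var vJ)) (Times (Var vOldK) (Minus (Var vJ) (Var vOldLast))))
               (Seq (Incr vOldIdx) (SetVar vOldLast (Var vJ))) Skip)
       (Seq (SetVar vDiag (Var vCol))
       (Seq (SetVar vCol (Plus (Cell vOld (Var vOldIdx)) (Minus (Var vJ) (Var vOldLast))))
       (Seq (SetVar vI (Lit 0))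
       (Seq next_column
            (Cond (Less (Gap (Var vPos) (Var vJ)) (Times (Var vK) (Minus (Var vJ) (Var vNewLast))))
               (Seq (Incr vNewIdx) (Seq (SetVar vNewLast (Var vJ))
                 (Assign vNew (Var vNewIdx) (Cell vCol (Var vLen))))) Skip))))))))"

definition copy_samples :: prog where
  "copy_samples =
     While (Less (Var vI) (Plus (Var vNewIdx) (Lit 1)))
       (Seq (Assign vOld (Var vI) (Cell vNew (Var vI))) (Incr vI))"

text \<open>The sweep starts at position 1, so the sample at 0 is stored in \<open>vNew\<close>
  beforehand. \<open>vNew\<close> is kept apart from \<open>vOld\<close>, which is still read during
  the sweep. \<open>vOldK\<close> is set last because the first sweep must see 0 there.\<close>

definition process_block :: prog where
  "process_block =
     Seq (SetVar vOldPos (Var vPos))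
     (Seq (SetVar vLen (Lit 0))
     (Seq read_block
     (Seq (SetVar vCol (Var vOld))
     (Seq (SetVar vI (Lit 0))
     (Seq init_column
     (Seq (SetVar vNew (Cell vCol (Var vLen)))
     (Seq (SetVar vJ (Lit 0))
     (Seq (SetVar vOldIdx (Lit 0))
     (Seq (SetVar vOldLast (Lit 0))
     (Seq (SetVar vNewIdx (Lit 0))
     (Seq (SetVar vNewLast (Lit 0))
     (Seq sweep
     (Seq (SetVar vI (Lit 0))
     (Seq copy_samples
          (SetVar vOldK (Var vK))))))))))))))))"

definition blockwise_dp :: prog where
  "blockwise_dp =
     Seq find_block_length
     (Seq (SetVar vK (Times (Var vParam) (Var vBlockLen)))
     (Seq (While (Less (Var vPos) OfflineLength) process_block)
          (SetVar vParam (Cell vCol (Var vLen)))))"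

text \<open>
  Parameters above \<open>4 * n + 1\<close> already make the result exact; capping them keeps the size of all
  memory cells logarithmic in \<open>n\<close>, independently of \<open>\<epsilon>\<close>.
\<close>

definition cap_param :: prog where
  "cap_param =
     (let c = Plus (Times (Lit 4) OfflineLength) (Lit 1)
      in Cond (Less c (Var vParam)) (SetVar vParam c) Skip)"

text \<open>The two conditions on \<open>b\<close> make it the least number with
  \<open>length t \<le> b * b\<close>. A row of \<open>cells\<close> must hold both a table column
  and all samples; \<open>vals\<close> must exceed characters, counters, table entries,
  \<open>K\<close> and the capped parameter.\<close>

locale sketch = bounded_memory t 20 cells vals
  for t :: "nat list" and cells vals :: nat +
  fixes s :: "nat list" and q b K :: nat
  assumes len: "length s = length t"
    and chars: "set t \<union> set s \<subseteq> {..<vals}"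
    and q: "q > 0"
    and b_upper: "length t \<le> b * b"
    and b_lower: "\<And>b'. b' < b \<Longrightarrow> b' * b' < length t"
    and K: "K = q * b"
    and b_cells: "b < cells"
    and sample_cells: "\<And>i. i \<le> length t \<Longrightarrow> sample_index K i (length t) < cells"
    and vals: "4 * length t + 2 < vals" "K < vals"
begin

abbreviation "n \<equiv> length t"

lemma b_le: "b \<le> n"
  using b_lower[of n] by (cases "b \<le> n") auto

lemma cells_pos [simp]: "0 < cells"
  using b_cells by simp

lemma nth_chars: "j < n \<Longrightarrow> t ! j < vals" "j < n \<Longrightarrow> s ! j < vals"
  using chars len by (auto simp: subset_iff)

section \<open>Correctness of the inner loops\<close>

lemma wp_find_block_length:
  assumes "M vBlockLen 0 = 0"
  shows "wp find_block_length
    (\<lambda>M' r'. r' = r \<and> M' vBlockLen 0 = b \<and> (\<forall>a. a \<noteq> vBlockLen \<longrightarrow> M' a = M a)) M r"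
  unfolding find_block_length_def
proof (rule wp_While[where I = "\<lambda>M' r'. r' = r \<and> M' vBlockLen 0 \<le> b \<and> (\<forall>a. a \<noteq> vBlockLen \<longrightarrow> M' a = M a)"
      and f = "\<lambda>M. b - M vBlockLen 0"])
  fix M' r'
  assume I: "r' = r \<and> M' vBlockLen 0 \<le> b \<and> (\<forall>a. a \<noteq> vBlockLen \<longrightarrow> M' a = M a)"
    and e: "eval n M' (Less (Times (Var vBlockLen) (Var vBlockLen)) OfflineLength) \<noteq> 0"
  have "M' vBlockLen 0 < b"
    using I e b_upper by (cases "M' vBlockLen 0 = b") (auto split: if_splits)
  then show "wp (Incr vBlockLen) (\<lambda>M'' r'. (r' = r \<and> M'' vBlockLen 0 \<le> b \<and>
      (\<forall>a. a \<noteq> vBlockLen \<longrightarrow> M'' a = M a)) \<and> b - M'' vBlockLen 0 < b - M' vBlockLen 0) M' r'"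
    using I b_le vals by (intro wp_Assign) auto
next
  fix M' r'
  assume I: "r' = r \<and> M' vBlockLen 0 \<le> b \<and> (\<forall>a. a \<noteq> vBlockLen \<longrightarrow> M' a = M a)"
    and e: "eval n M' (Less (Times (Var vBlockLen) (Var vBlockLen)) OfflineLength) = 0"
  then show "r' = r \<and> M' vBlockLen 0 = b \<and> (\<forall>a. a \<noteq> vBlockLen \<longrightarrow> M' a = M a)"
    using b_lower[of "M' vBlockLen 0"] by (auto simp: le_less split: if_splits)
qed (use assms in auto)

lemma wp_read_block:
  assumes "M vBlockLen 0 = b" "M vPos 0 = i" "i \<le> n" "M vLen 0 = 0"
    and L: "L = min b (n - i)"
  shows "wp read_block
    (\<lambda>M' r'. r' = drop (i + L) s \<and> M' vLen 0 = L \<and> M' vPos 0 = i + L \<and>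
       (\<forall>k<L. M' vBlock k = s ! (i + k)) \<and>
       (\<forall>a. a \<notin> {vLen, vPos, vBlock} \<longrightarrow> M' a = M a)) M (drop i s)"
  unfolding read_block_def
proof (rule wp_While[where f = "\<lambda>M. b - M vLen 0" and
      I = "\<lambda>M' r'. \<exists>l\<le>L. r' = drop (i + l) s \<and> M' vLen 0 = l \<and> M' vPos 0 = i + l \<and>
       (\<forall>k<l. M' vBlock k = s ! (i + k)) \<and> (\<forall>a. a \<notin> {vLen, vPos, vBlock} \<longrightarrow> M' a = M a)"],
      goal_cases)
  case 1
  then show ?case using assms by auto
next
  case (2 M' r')
  then obtain l where l: "l \<le> L" "r' = drop (i + l) s" "M' vLen 0 = l" "M' vPos 0 = i + l"
    "\<forall>k<l. M' vBlock k = s ! (i + k)" "\<forall>a. a \<notin> {vLen, vPos, vBlock} \<longrightarrow> M' a = M a"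
    by blast
  have less: "l < L" "l < b" "i + l < n" "M' vBlockLen 0 = b"
    using 2(2) l assms by (auto split: if_splits)
  have r: "r' = s ! (i + l) # drop (i + Suc l) s"
    using l less len by (simp add: Cons_nth_drop_Suc)
  show ?case unfolding r
    by (intro wp_Seq wp_Read wp_Assign; (rule exI[of _ "Suc l"])?)
      (use l less b_cells vals b_le nth_chars in \<open>auto simp: less_Suc_eq\<close>)
next
  case (3 M' r')
  then obtain l where l: "l \<le> L" "r' = drop (i + l) s" "M' vLen 0 = l" "M' vPos 0 = i + l"
    "\<forall>k<l. M' vBlock k = s ! (i + k)" "\<forall>a. a \<notin> {vLen, vPos, vBlock} \<longrightarrow> M' a = M a"
    by blast
  have "l = L" using 3(2) l assms by (auto split: if_splits)
  then show ?case using l by simp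
qed

lemma wp_init_column:
  assumes "M vLen 0 = L" "L \<le> b" "M vI 0 = 0" "M vCol 0 = x" "x \<le> n"
  shows "wp init_column
    (\<lambda>M' r'. r' = r \<and> (\<forall>k\<le>L. M' vCol k = x + k) \<and>
       (\<forall>a. a \<notin> {vI, vCol} \<longrightarrow> M' a = M a)) M r"
  unfolding init_column_def
proof (rule wp_While[where f = "\<lambda>M. L - M vI 0" and
      I = "\<lambda>M' r'. r' = r \<and> M' vI 0 \<le> L \<and> (\<forall>k\<le>M' vI 0. M' vCol k = x + k) \<and>
       (\<forall>a. a \<notin> {vI, vCol} \<longrightarrow> M' a = M a)"],
      goal_cases)
  case (2 M' r')
  then have less: "M' vI 0 < L" "M' vLen 0 = L" using assms by (auto split: if_splits)
  show ?case
    by (intro wp_Seq wp_Assign) (use 2(1) less assms b_cells vals b_le in \<open>auto simp: le_Suc_eq\<close>)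
qed (use assms in \<open>auto split: if_splits\<close>)

lemma wp_next_column:
  fixes c d F :: "nat \<Rightarrow> nat"
  defines "T \<equiv> edit_table c d F"
  assumes "M vLen 0 = L" "L \<le> b" "M vI 0 = 0" "M vDiag 0 = T 0 j" "M vCol 0 = T 0 (Suc j)"
    and "\<forall>k. 0 < k \<and> k \<le> L \<longrightarrow> M vCol k = T k j"
    and "\<forall>k<L. M vBlock k = c k" "M vChar 0 = d j"
    and T: "\<forall>k\<le>L. T k j < vals \<and> T k (Suc j) < vals"
  shows "wp next_column
    (\<lambda>M' r'. r' = r \<and> (\<forall>k\<le>L. M' vCol k = T k (Suc j)) \<and>
       (\<forall>a. a \<notin> {vI, vCol, vDiag, vTmp} \<longrightarrow> M' a = M a)) M r"
  unfolding next_column_def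
proof (rule wp_While[where f = "\<lambda>M. L - M vI 0" and
      \<comment> \<open>Up to the counter the array already holds column \<open>Suc j\<close>,
        beyond it still column \<open>j\<close>.\<close>
      I = "\<lambda>M' r'. r' = r \<and> M' vI 0 \<le> L \<and> M' vDiag 0 = T (M' vI 0) j \<and>
       (\<forall>k\<le>M' vI 0. M' vCol k = T k (Suc j)) \<and>
       (\<forall>k. M' vI 0 < k \<and> k \<le> L \<longrightarrow> M' vCol k = T k j) \<and>
       (\<forall>a. a \<notin> {vI, vCol, vDiag, vTmp} \<longrightarrow> M' a = M a)"],
      goal_cases)
  case (2 M' r')
  define k where "k = M' vI 0"
  have less: "k < L" "M' vLen 0 = L" using 2 assms by (auto simp: k_def split: if_splits)
  have col: "M' vCol k = T k (Suc j)" "M' vCol (Suc k) = T (Suc k) j" "M' vDiag 0 = T k j"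
    "M' vBlock k = c k" "M' vChar 0 = d j"
    using 2 less assms by (auto simp: k_def)
  have new: "min (min (Suc (T (Suc k) j)) (Suc (T k (Suc j)))) (T k j + of_bool (c k \<noteq> d j)) = T (Suc k) (Suc j)"
    by (simp add: T_def min.commute)
  have "T (Suc k) j < vals" "T (Suc k) (Suc j) < vals" using T less by auto
  then show ?case
    by (intro wp_Seq wp_Assign)
      (use 2(1) less col new assms(3) b_cells vals b_le in \<open>auto simp: le_Suc_eq k_def[symmetric]\<close>)
qed (use assms in \<open>auto split: if_splits\<close>)

lemma wp_copy_samples:
  assumes "M vI 0 = 0" "M vNewIdx 0 = x" "x < cells" "x \<le> n" "\<forall>k\<le>x. M vNew k < vals"
  shows "wp copy_samples
    (\<lambda>M' r'. r' = r \<and> (\<forall>k\<le>x. M' vOld k = M vNew k) \<and>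
       (\<forall>a. a \<notin> {vI, vOld} \<longrightarrow> M' a = M a)) M r"
  unfolding copy_samples_def
proof (rule wp_While[where f = "\<lambda>M. Suc x - M vI 0" and
      I = "\<lambda>M' r'. r' = r \<and> M' vI 0 \<le> Suc x \<and> (\<forall>k<M' vI 0. M' vOld k = M vNew k) \<and>
       (\<forall>a. a \<notin> {vI, vOld} \<longrightarrow> M' a = M a)"],
      goal_cases)
  case (2 M' r')
  then have less: "M' vI 0 \<le> x" "M' vNewIdx 0 = x" using assms by (auto split: if_splits)
  then show ?case
    by (intro wp_Seq wp_Assign) (use 2(1) assms vals in \<open>auto simp: less_Suc_eq\<close>)
qed (use assms in \<open>auto split: if_splits\<close>)

text \<open>Stored samples are described through all positions: the cell indexed by \<open>j\<close>
  holds the value at the last sample up to \<open>j\<close>. The sample positions themselves then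
  never have to be listed.\<close>

lemma wp_sweep:
  fixes c A :: "nat \<Rightarrow> nat" and Ko io i L :: nat
  defines "F \<equiv> interpolate Ko io A"
  defines "T \<equiv> edit_table c ((!) t) F"
  defines "Inv \<equiv> \<lambda>M' j. j \<le> n \<and> M' vJ 0 = j \<and>
    M' vOldIdx 0 = sample_index Ko io j \<and> M' vOldLast 0 = last_sample Ko io j \<and>
    M' vNewIdx 0 = sample_index K i j \<and> M' vNewLast 0 = last_sample K i j \<and>
    (\<forall>k\<le>L. M' vCol k = T k j) \<and>
    (\<forall>j'\<le>j. M' vNew (sample_index K i j') = T L (last_sample K i j'))"
  assumes M: "M vK 0 = K" "M vOldK 0 = Ko" "M vPos 0 = i" "M vOldPos 0 = io" "M vLen 0 = L"
    and L: "L \<le> b" "i \<le> n"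
    and block: "\<forall>k<L. M vBlock k = c k"
    and old: "\<forall>j\<le>n. M vOld (sample_index Ko io j) = A (last_sample Ko io j)"
    and init: "Inv M 0"
    and T: "\<forall>k\<le>L. \<forall>j\<le>n. T k j \<le> 2 * n"
  shows "wp sweep (\<lambda>M' r'. r' = r \<and> Inv M' n \<and>
       (\<forall>a. a \<notin> {vCol, vNew, vJ, vOldIdx, vOldLast, vNewIdx, vNewLast, vI, vDiag, vChar, vTmp}
          \<longrightarrow> M' a = M a)) M r"
  unfolding sweep_def
proof (rule wp_While[where f = "\<lambda>M. n - M vJ 0" and
      I = "\<lambda>M' r'. r' = r \<and> (\<exists>j. Inv M' j) \<and>
       (\<forall>a. a \<notin> {vCol, vNew, vJ, vOldIdx, vOldLast, vNewIdx, vNewLast, vI, vDiag, vChar, vTmp}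
          \<longrightarrow> M' a = M a)"],
      goal_cases)
  case 1
  then show ?case using init by auto
next
  case (2 M' r')
  then obtain j where r: "r' = r" and inv: "Inv M' j" and frame: "\<forall>a. a \<notin> {vCol, vNew, vJ, vOldIdx,
      vOldLast, vNewIdx, vNewLast, vI, vDiag, vChar, vTmp} \<longrightarrow> M' a = M a"
    by blast
  have j: "j < n" "M' vJ 0 = j" using 2(2) inv by (auto simp: Inv_def split: if_splits)
  have M': "M' vK 0 = K" "M' vOldK 0 = Ko" "M' vPos 0 = i" "M' vOldPos 0 = io" "M' vLen 0 = L"
    "\<forall>k<L. M' vBlock k = c k" "M' vOld (sample_index Ko io (Suc j)) = A (last_sample Ko io (Suc j))"
    using frame M block old j by (auto simp del: sample_index.simps last_sample.simps)
  \<comment> \<open>The state just before \<open>next_column\<close>: the top entry belongs to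
    column \<open>Suc j\<close>, the others to column \<open>j\<close>.\<close>
  define mid where "mid M1 r1 \<longleftrightarrow> r1 = r \<and> M1 vI 0 = 0 \<and> M1 vJ 0 = Suc j \<and> M1 vChar 0 = t ! j \<and>
      M1 vOldIdx 0 = sample_index Ko io (Suc j) \<and> M1 vOldLast 0 = last_sample Ko io (Suc j) \<and>
      M1 vDiag 0 = T 0 j \<and> M1 vCol 0 = T 0 (Suc j) \<and> (\<forall>k. 0 < k \<longrightarrow> M1 vCol k = M' vCol k) \<and>
      (\<forall>a. a \<notin> {vCol, vJ, vOldIdx, vOldLast, vI, vDiag, vChar} \<longrightarrow> M1 a = M' a)" for M1 :: store and r1
  have small: "sample_index Ko io (Suc j) < vals" "last_sample Ko io (Suc j) < vals"
     "sample_index K i (Suc j) < vals" "last_sample K i (Suc j) < vals"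
    using sample_index_le_self[of Ko io "Suc j"] last_sample_le[of Ko io "Suc j"]
      sample_index_le_self[of K i "Suc j"] last_sample_le[of K i "Suc j"] j vals by linarith+
  have T0: "T 0 (Suc j) = A (last_sample Ko io (Suc j)) + (Suc j - last_sample Ko io (Suc j))"
    by (simp only: T_def edit_table.simps F_def interpolate_def)
  have Tv: "T k j' < vals" if "k \<le> L" "j' \<le> n" for k j'
  proof -
    have "T k j' \<le> 2 * n" using T that by blast
    then show ?thesis using vals(1) by linarith
  qed
  have new_cells: "sample_index K i (Suc j) < cells"
    using sample_cells[of i] sample_index_mono[of "Suc j" n K i] L j by linarith
  have Tj: "T 0 j < vals" "T 0 (Suc j) < vals" "T L (Suc j) < vals" using Tv j by auto
  have old_col: "M' vCol 0 = T 0 j" "\<And>k. k \<le> L \<Longrightarrow> M' vCol k = T k j"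
    "M' vOldIdx 0 = sample_index Ko io j" "M' vOldLast 0 = last_sample Ko io j"
    "M' vNewIdx 0 = sample_index K i j" "M' vNewLast 0 = last_sample K i j"
    "\<And>j'. j' \<le> j \<Longrightarrow> M' vNew (sample_index K i j') = T L (last_sample K i j')"
    using inv by (auto simp: Inv_def)
  have step2: "wp next_column (wp (Cond (Less (Gap (Var vPos) (Var vJ)) (Times (Var vK) (Minus (Var vJ) (Var vNewLast))))
               (Seq (Incr vNewIdx) (Seq (SetVar vNewLast (Var vJ))
                 (Assign vNew (Var vNewIdx) (Cell vCol (Var vLen))))) Skip)
         (\<lambda>M'' r'. (r' = r \<and> (\<exists>j. Inv M'' j) \<and>
       (\<forall>a. a \<notin> {vCol, vNew, vJ, vOldIdx, vOldLast, vNewIdx, vNewLast, vI, vDiag, vChar, vTmp}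
          \<longrightarrow> M'' a = M a)) \<and> n - M'' vJ 0 < n - M' vJ 0)) M1 r1"
    if m: "mid M1 r1" for M1 r1
  proof (rule wp_mono[OF wp_next_column[where c = c and d = "(!) t" and F = F and L = L and j = j and r = r1]])
    fix M2 r2
    assume M2: "r2 = r1 \<and> (\<forall>k\<le>L. M2 vCol k = edit_table c ((!) t) F k (Suc j)) \<and>
       (\<forall>a. a \<notin> {vI, vCol, vDiag, vTmp} \<longrightarrow> M2 a = M1 a)"
    have f: "r2 = r" "M2 vJ 0 = Suc j"  "M2 vOldIdx 0 = sample_index Ko io (Suc j)"
      "M2 vOldLast 0 = last_sample Ko io (Suc j)" "\<And>k. k \<le> L \<Longrightarrow> M2 vCol k = T k (Suc j)"
      "M2 vK 0 = K" "M2 vPos 0 = i" "M2 vLen 0 = L"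
      "M2 vNewIdx 0 = sample_index K i j" "M2 vNewLast 0 = last_sample K i j"
      "\<And>j'. j' \<le> j \<Longrightarrow> M2 vNew (sample_index K i j') = T L (last_sample K i j')"
      "\<forall>a. a \<notin> {vCol, vNew, vJ, vOldIdx, vOldLast, vNewIdx, vNewLast, vI, vDiag, vChar, vTmp}
          \<longrightarrow> M2 a = M a"
      using M2 m M' old_col frame by (auto simp: mid_def T_def)
    have fresh: "sample_index K i j' \<noteq> Suc (sample_index K i j)" if "j' \<le> j" for j'
      using sample_index_mono[OF that, of K i] by simp
    show "wp (Cond (Less (Gap (Var vPos) (Var vJ)) (Times (Var vK) (Minus (Var vJ) (Var vNewLast))))
               (Seq (Incr vNewIdx) (Seq (SetVar vNewLast (Var vJ))
                 (Assign vNew (Var vNewIdx) (Cell vCol (Var vLen))))) Skip)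
         (\<lambda>M'' r'. (r' = r \<and> (\<exists>j. Inv M'' j) \<and>
       (\<forall>a. a \<notin> {vCol, vNew, vJ, vOldIdx, vOldLast, vNewIdx, vNewLast, vI, vDiag, vChar, vTmp}
          \<longrightarrow> M'' a = M a)) \<and> n - M'' vJ 0 < n - M' vJ 0) M2 r2"
    proof (rule wp_Cond)
      assume "eval n M2 (Less (Gap (Var vPos) (Var vJ)) (Times (Var vK) (Minus (Var vJ) (Var vNewLast)))) \<noteq> 0"
      then have s: "gap i (Suc j) < K * (Suc j - last_sample K i j)"
        by (simp add: f(1-11) split: if_splits)
      then have s': "sample_index K i (Suc j) = Suc (sample_index K i j)" "last_sample K i (Suc j) = Suc j"
        by auto
      show "wp (Seq (Incr vNewIdx) (Seq (SetVar vNewLast (Var vJ))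
                 (Assign vNew (Var vNewIdx) (Cell vCol (Var vLen)))))
         (\<lambda>M'' r'. (r' = r \<and> (\<exists>j. Inv M'' j) \<and>
       (\<forall>a. a \<notin> {vCol, vNew, vJ, vOldIdx, vOldLast, vNewIdx, vNewLast, vI, vDiag, vChar, vTmp}
          \<longrightarrow> M'' a = M a)) \<and> n - M'' vJ 0 < n - M' vJ 0) M2 r2"
        apply (intro wp_Seq wp_Assign conjI exI[of _ "Suc j"])
        using f(1,12) j small new_cells Tj s' unfolding Inv_def
        by (auto simp: f(2-11) M fresh s' le_Suc_eq simp del: sample_index.simps last_sample.simps)
    next
      assume "eval n M2 (Less (Gap (Var vPos) (Var vJ)) (Times (Var vK) (Minus (Var vJ) (Var vNewLast)))) = 0"
      then have s: "\<not> gap i (Suc j) < K * (Suc j - last_sample K i j)"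
        by (simp add: f(1-11) split: if_splits)
      then have s': "sample_index K i (Suc j) = sample_index K i j" "last_sample K i (Suc j) = last_sample K i j"
        by auto
      show "wp Skip
         (\<lambda>M'' r'. (r' = r \<and> (\<exists>j. Inv M'' j) \<and>
       (\<forall>a. a \<notin> {vCol, vNew, vJ, vOldIdx, vOldLast, vNewIdx, vNewLast, vI, vDiag, vChar, vTmp}
          \<longrightarrow> M'' a = M a)) \<and> n - M'' vJ 0 < n - M' vJ 0) M2 r2"
        apply (intro wp_Skip conjI exI[of _ "Suc j"])
        using f(1,12) j unfolding Inv_def
        by (auto simp: f(2-11) M s' le_Suc_eq simp del: sample_index.simps last_sample.simps)
    qed
  qed (use m M' L old_col j Tv in \<open>auto simp: mid_def T_def\<close>)
  \<comment> \<open>Both branches have the effect of assigning index and position of the last sample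
    for \<open>Suc j\<close>, which spares the rest of the body a case distinction. Without a new
    sample these assignments change nothing.\<close>
  have cond: "wp (Cond (Less (Gap (Var vOldPos) (Var vJ)) (Times (Var vOldK) (Minus (Var vJ) (Var vOldLast))))
               (Seq (Incr vOldIdx) (SetVar vOldLast (Var vJ))) Skip) Q M1 r1"
    if "M1 = upd (upd M' vChar 0 (t ! j)) vJ 0 (Suc j)"
       "Q (upd (upd M1 vOldIdx 0 (sample_index Ko io (Suc j))) vOldLast 0 (last_sample Ko io (Suc j))) r1"
    for Q M1 r1
  proof (rule wp_Cond)
    assume e: "eval n M1 (Less (Gap (Var vOldPos) (Var vJ)) (Times (Var vOldK) (Minus (Var vJ) (Var vOldLast)))) \<noteq> 0"
    have "gap io (Suc j) < Ko * (Suc j - last_sample Ko io j)"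
      using e by (simp add: that(1) M' old_col split: if_splits)
    then have s': "sample_index Ko io (Suc j) = Suc (sample_index Ko io j)" "last_sample Ko io (Suc j) = Suc j"
      by auto
    show "wp (Seq (Incr vOldIdx) (SetVar vOldLast (Var vJ))) Q M1 r1"
      by (intro wp_Seq wp_Assign)
        (use that small s' in \<open>auto simp: old_col simp del: sample_index.simps last_sample.simps\<close>)
  next
    assume e: "eval n M1 (Less (Gap (Var vOldPos) (Var vJ)) (Times (Var vOldK) (Minus (Var vJ) (Var vOldLast)))) = 0"
    have "\<not> gap io (Suc j) < Ko * (Suc j - last_sample Ko io j)"
      using e by (simp add: that(1) M' old_col split: if_splits)
    then have s': "sample_index Ko io (Suc j) = sample_index Ko io j" "last_sample Ko io (Suc j) = last_sample Ko io j"
      by auto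
    have "upd (upd M1 vOldIdx 0 (sample_index Ko io (Suc j))) vOldLast 0 (last_sample Ko io (Suc j)) = M1"
      unfolding s' by (auto simp: fun_eq_iff upd_apply that(1) old_col)
    then show "wp Skip Q M1 r1" using that by (intro wp_Skip) simp
  qed
  show ?case
    apply (intro wp_Seq wp_Query wp_Assign cond step2)
    using j vals nth_chars(1)[OF j(1)] small Tj M' old_col r
    by (auto simp: T0[symmetric] mid_def simp del: sample_index.simps last_sample.simps)
next
  case (3 M' r')
  then show ?case by (auto simp: Inv_def split: if_splits)
qed

section \<open>Correctness of the loop over blocks\<close>

abbreviation error :: "nat \<Rightarrow> real" where
  "error m \<equiv> (1 + 1 / real K) ^ m - 1"

text \<open>\<open>A\<close> is a whole row of which only samples are in memory, hence the
  existential quantifier. The last clause concerns the answer, which is the bottom entry of the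
  final column; if \<open>n = 0\<close> it must hold for the initial zero cell.\<close>

definition block_inv :: "nat \<Rightarrow> store \<Rightarrow> nat list \<Rightarrow> bool" where
  "block_inv m M r \<longleftrightarrow> m \<le> b \<and> M vBlockLen 0 = b \<and> M vK 0 = K \<and>
     M vPos 0 = min (m * b) n \<and> r = drop (min (m * b) n) s \<and>
     (\<exists>A. (\<forall>j\<le>n. M vOld (sample_index (M vOldK 0) (min (m * b) n) j)
            = A (last_sample (M vOldK 0) (min (m * b) n) j)) \<and>
        approx_row ((!) s) ((!) t) (error m) (min (m * b) n)
          (interpolate (M vOldK 0) (min (m * b) n) A)) \<and>
     (n \<le> m * b \<longrightarrow> ed s t \<le> M vCol (M vLen 0) \<and> M vCol (M vLen 0) \<le> 2 * n \<and>
        real (M vCol (M vLen 0)) \<le> (1 + error b) * real (ed s t))"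

lemma wp_process_block:
  assumes inv: "block_inv m M r" and less: "m * b < n"
  shows "wp process_block (\<lambda>M' r'. block_inv (Suc m) M' r') M r"
proof -
  define i where "i = m * b"
  have i: "min (m * b) n = i" "i < n" using less by (auto simp: i_def)
  define Ko where "Ko = M vOldK 0"
  obtain A where m: "m \<le> b" and M: "M vBlockLen 0 = b" "M vK 0 = K" "M vPos 0 = i" "r = drop i s"
    and old: "\<forall>j\<le>n. M vOld (sample_index Ko i j) = A (last_sample Ko i j)"
    and approx: "approx_row ((!) s) ((!) t) (error m) i (interpolate Ko i A)"
    using inv unfolding block_inv_def i Ko_def by blast
  define L where "L = min b (n - i)"
  have L: "L \<le> b" "i + L \<le> n" using i by (auto simp: L_def)
  define F where "F = interpolate Ko i A"
  define T where "T = edit_table (\<lambda>k. s ! (i + k)) ((!) t) F"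
  have err: "error m \<ge> 0" by simp
  have T_approx: "approx_row ((!) s) ((!) t) (error m) (i + L) (T L)"
    unfolding T_def using approx_row_edit_table[OF approx err] by (simp add: F_def)
  have T_le: "T k j \<le> i + k + j" for k j
    unfolding T_def by (rule edit_table_le) (use approx_row_bound[OF approx] in \<open>simp add: F_def\<close>)
  have T_bound: "\<forall>k\<le>L. \<forall>j\<le>n. T k j \<le> 2 * n"
    using T_le L by (metis (no_types, lifting) add_le_mono le_trans nat_add_left_cancel_le mult_2)
  have F0: "F 0 = A 0" by (simp add: F_def interpolate_def)
  have A0: "A 0 \<le> n" "M vOld 0 = A 0"
    using approx_row_bound[OF approx, of 0] F0 old[rule_format, of 0] i by (auto simp: F_def)
  have T0: "T k 0 = A 0 + k" for k
    using F0 by (induction k) (auto simp: T_def)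
  \<comment> \<open>\<open>m * b < n \<le> b * b\<close>: at most \<open>b\<close> blocks are
    processed.\<close>
  have b_less: "m < b" using less b_upper by (metis le_less_trans less_le_not_le mult_le_cancel2 not_less)
  have K_pos: "K > 0" using K q b_less by simp
  have i': "min (Suc m * b) n = i + L" using less by (auto simp: i_def L_def min_def)
  have final: "block_inv (Suc m) M' r'"
    if "r' = drop (i + L) s" "M' vBlockLen 0 = b" "M' vK 0 = K" "M' vOldK 0 = K" "M' vPos 0 = i + L"
      "M' vLen 0 = L" "M' vCol L = T L n"
      "\<forall>j\<le>n. M' vOld (sample_index K (i + L) j) = T L (last_sample K (i + L) j)" for M' r'
  proof -
    have "approx_row ((!) s) ((!) t) (error (Suc m)) (i + L) (interpolate K (i + L) (T L))"
      using approx_row_interpolate[OF T_approx err K_pos] by (simp add: mult.commute)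
    moreover have "ed s t \<le> T L n \<and> real (T L n) \<le> (1 + error b) * real (ed s t)" if "n \<le> Suc m * b"
    proof -
      \<comment> \<open>At the end of both strings the gap vanishes, so the error is relative to the
        edit distance alone. The answer is read from the exact column, before the last sampling, so
        \<open>error m\<close> suffices.\<close>
      have iL: "i + L = n" using i' that by simp
      have "edit_table ((!) s) ((!) t) (\<lambda>j. j) n n = ed s t"
        using edit_table_eq_ed[of n s n t] len by simp
      then have "ed s t \<le> T L n" "real (T L n) \<le> real (ed s t) + error m * real (ed s t)"
        using T_approx[unfolded approx_row_def, rule_format, of n] iL by auto
      moreover have "error m * real (ed s t) \<le> error b * real (ed s t)"
        using m by (intro mult_right_mono diff_right_mono power_increasing) auto
      ultimately show ?thesis by (simp add: algebra_simps)
    qed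
    ultimately show ?thesis
      unfolding block_inv_def i' using that b_less T_bound by auto
  qed
  \<comment> \<open>The block is verified from its end: \<open>tail\<close>,
    \<open>sweep_tail\<close> and \<open>init_tail\<close> each prepend commands to the previous
    one.\<close>
  have tail: "wp (Seq (SetVar vI (Lit 0)) (Seq copy_samples (SetVar vOldK (Var vK)))) (block_inv (Suc m))
      M' (drop (i + L) s)"
    if "M' vBlockLen 0 = b" "M' vK 0 = K" "M' vPos 0 = i + L" "M' vLen 0 = L" "M' vCol L = T L n"
      "M' vNewIdx 0 = sample_index K (i + L) n"
      and new: "\<forall>j\<le>n. M' vNew (sample_index K (i + L) j) = T L (last_sample K (i + L) j)" for M'
  proof (intro wp_Seq wp_Assign)
    let ?M = "upd M' vI (eval n M' (Lit 0)) (eval n M' (Lit 0))"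
    have new_vals: "\<forall>k\<le>sample_index K (i + L) n. M' vNew k < vals"
    proof (intro allI impI)
      fix k assume "k \<le> sample_index K (i + L) n"
      then obtain j where "j \<le> n" "sample_index K (i + L) j = k"
        using sample_index_onto by blast
      then show "M' vNew k < vals"
        using new T_bound[rule_format, of L "last_sample K (i + L) j"] last_sample_le[of K "i + L" j] vals(1)
        by fastforce
    qed
    show "wp copy_samples (wp (SetVar vOldK (Var vK)) (block_inv (Suc m))) ?M (drop (i + L) s)"
    proof (rule wp_mono[OF wp_copy_samples[where x = "sample_index K (i + L) n" and r = "drop (i + L) s"]])
      fix M'' r''
      assume M'': "r'' = drop (i + L) s \<and> (\<forall>k\<le>sample_index K (i + L) n. M'' vOld k = ?M vNew k) \<and>
        (\<forall>a. a \<notin> {vI, vOld} \<longrightarrow> M'' a = ?M a)"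
      have "\<forall>j\<le>n. M'' vOld (sample_index K (i + L) j) = T L (last_sample K (i + L) j)"
        using M'' new sample_index_mono[of _ n K "i + L"] by auto
      then show "wp (SetVar vOldK (Var vK)) (block_inv (Suc m)) M'' r''"
        using M'' that vals by (intro wp_Assign final) auto
    qed (use that new_vals L sample_cells sample_index_le_self in auto)
  qed (use vals in auto)
  have sweep_tail: "wp (Seq sweep (Seq (SetVar vI (Lit 0)) (Seq copy_samples (SetVar vOldK (Var vK)))))
      (block_inv (Suc m)) M' (drop (i + L) s)"
    if "M' vBlockLen 0 = b" "M' vK 0 = K" "M' vOldK 0 = Ko" "M' vPos 0 = i + L" "M' vOldPos 0 = i"
      "M' vLen 0 = L" "\<forall>k<L. M' vBlock k = s ! (i + k)" "M' vOld = M vOld"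
      "M' vJ 0 = 0" "M' vOldIdx 0 = 0" "M' vOldLast 0 = 0" "M' vNewIdx 0 = 0" "M' vNewLast 0 = 0"
      "\<forall>k\<le>L. M' vCol k = T k 0" "M' vNew 0 = T L 0" for M'
  proof (rule wp_Seq, rule wp_mono[OF wp_sweep[where Ko = Ko and io = i and i = "i + L" and A = A and
          L = L and c = "\<lambda>k. s ! (i + k)" and r = "drop (i + L) s"]], goal_cases)
    case (12 M'' r'')
    then have r'': "r'' = drop (i + L) s" by simp
    show ?case unfolding r''
      by (rule tail) (use 12 that in \<open>auto simp: T_def F_def\<close>)
  qed (use that L T_bound old in \<open>auto simp: T_def F_def\<close>)
  have init_tail: "wp (Seq init_column
     (Seq (SetVar vNew (Cell vCol (Var vLen)))
     (Seq (SetVar vJ (Lit 0))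
     (Seq (SetVar vOldIdx (Lit 0))
     (Seq (SetVar vOldLast (Lit 0))
     (Seq (SetVar vNewIdx (Lit 0))
     (Seq (SetVar vNewLast (Lit 0))
     (Seq sweep (Seq (SetVar vI (Lit 0)) (Seq copy_samples (SetVar vOldK (Var vK))))))))))))
      (block_inv (Suc m)) M' (drop (i + L) s)"
    if "M' vBlockLen 0 = b" "M' vK 0 = K" "M' vOldK 0 = Ko" "M' vPos 0 = i + L" "M' vOldPos 0 = i"
      "M' vLen 0 = L" "\<forall>k<L. M' vBlock k = s ! (i + k)" "M' vOld = M vOld"
      "M' vI 0 = 0" "M' vCol 0 = A 0" for M'
  proof (rule wp_Seq, rule wp_mono[OF wp_init_column[where L = L and x = "A 0" and r = "drop (i + L) s"]], goal_cases)
    case (6 M'' r'')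
    then have r'': "r'' = drop (i + L) s" by simp
    have "A 0 + L < vals" using A0 L b_le vals by linarith
    then show ?case unfolding r''
      by (intro wp_Seq[of "SetVar x y" for x y] wp_Assign sweep_tail) (use 6 that vals in \<open>auto simp: T0\<close>)
  qed (use that L A0 in auto)
  have "wp read_block (wp (Seq (SetVar vCol (Var vOld)) (Seq (SetVar vI (Lit 0)) (Seq init_column
     (Seq (SetVar vNew (Cell vCol (Var vLen)))
     (Seq (SetVar vJ (Lit 0))
     (Seq (SetVar vOldIdx (Lit 0))
     (Seq (SetVar vOldLast (Lit 0))
     (Seq (SetVar vNewIdx (Lit 0))
     (Seq (SetVar vNewLast (Lit 0))
     (Seq sweep (Seq (SetVar vI (Lit 0)) (Seq copy_samples (SetVar vOldK (Var vK))))))))))))))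
      (block_inv (Suc m))) (upd (upd M vOldPos 0 i) vLen 0 0) (drop i s)"
  proof (rule wp_mono[OF wp_read_block[where i = i and L = L]], goal_cases)
    case (6 M' r')
    then have r': "r' = drop (i + L) s" by simp
    show ?case unfolding r'
      by (intro wp_Seq[of "SetVar x y" for x y] wp_Assign init_tail) (use 6 M A0 vals in \<open>auto simp: Ko_def\<close>)
  qed (use M i in \<open>auto simp: L_def\<close>)
  then show ?thesis
    unfolding process_block_def M(4)
    by (intro wp_Seq[of "SetVar x y" for x y] wp_Assign wp_Seq[of read_block]) (use M i vals in auto)
qed

lemma block_inv_0:
  assumes "\<And>a. a \<notin> {vParam, vBlockLen, vK} \<Longrightarrow> M a = (\<lambda>_. 0)" "M vBlockLen 0 = b" "M vK 0 = K"
  shows "block_inv 0 M s"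
proof -
  have "interpolate 0 0 (\<lambda>_. 0) = (\<lambda>j. j)" by (auto simp: interpolate_def)
  moreover have "ed s t = 0" if "n = 0"
    using that len edit_table_eq_ed[of 0 s 0 t] by simp
  ultimately show ?thesis
    using assms approx_row_0[of "(!) s" "(!) t"]
    by (auto simp: block_inv_def intro!: exI[of _ "\<lambda>_. 0"])
qed

lemma wp_blockwise_dp:
  assumes M: "\<And>a. a \<noteq> vParam \<Longrightarrow> M a = (\<lambda>_. 0)" "M vParam 0 = q"
  shows "wp blockwise_dp (\<lambda>M' r'. ed s t \<le> M' vParam 0 \<and>
     real (M' vParam 0) \<le> (1 + error b) * real (ed s t)) M s"
proof -
  have loop: "wp (While (Less (Var vPos) OfflineLength) process_block)
     (wp (SetVar vParam (Cell vCol (Var vLen))) (\<lambda>M' r'. ed s t \<le> M' vParam 0 \<and>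
       real (M' vParam 0) \<le> (1 + error b) * real (ed s t))) M1 s" if init: "block_inv 0 M1 s" for M1
  proof (rule wp_While[where I = "\<lambda>M r. \<exists>m. block_inv m M r" and f = "\<lambda>M. n - M vPos 0"], goal_cases)
    case (2 M' r')
    then obtain m where m: "block_inv m M' r'" by blast
    then have less: "m * b < n"
      using 2(2) by (auto simp: block_inv_def split: if_splits)
    \<comment> \<open>A positive block length makes the position advance, so the loop
      terminates.\<close>
    have "b > 0" using less b_upper by (cases b) auto
    show ?case
    proof (rule wp_mono[OF wp_process_block[OF m less]])
      fix M'' r''
      assume inv: "block_inv (Suc m) M'' r''"
      then have "M'' vPos 0 = min (Suc m * b) n" "M' vPos 0 = min (m * b) n"
        using m by (auto simp: block_inv_def)
      then show "(\<exists>m. block_inv m M'' r'') \<and> n - M'' vPos 0 < n - M' vPos 0"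
        using inv less \<open>b > 0\<close> by auto
    qed
  next
    case (3 M' r')
    then obtain m where m: "block_inv m M' r'" by blast
    then have "n \<le> m * b"
      using 3(2) by (auto simp: block_inv_def split: if_splits)
    then have bd: "ed s t \<le> M' vCol (M' vLen 0)" "M' vCol (M' vLen 0) \<le> 2 * n"
        "real (M' vCol (M' vLen 0)) \<le> (1 + error b) * real (ed s t)"
      using m by (auto simp: block_inv_def)
    show ?case by (intro wp_Assign) (use bd vals in auto)
  qed (use init in blast)
  show ?thesis
    unfolding blockwise_dp_def
  proof (rule wp_Seq, rule wp_mono[OF wp_find_block_length[where r = s]])
    fix M1 r1
    assume M1: "r1 = s \<and> M1 vBlockLen 0 = b \<and> (\<forall>a. a \<noteq> vBlockLen \<longrightarrow> M1 a = M a)"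
    then have r1: "r1 = s" and K': "M1 vParam 0 * M1 vBlockLen 0 = K" using M K by auto
    show "wp (Seq (SetVar vK (Times (Var vParam) (Var vBlockLen)))
      (Seq (While (Less (Var vPos) OfflineLength) process_block)
        (SetVar vParam (Cell vCol (Var vLen))))) (\<lambda>M' r'. ed s t \<le> M' vParam 0 \<and>
          real (M' vParam 0) \<le> (1 + error b) * real (ed s t)) M1 r1"
      unfolding r1 by (intro wp_Seq wp_Assign loop block_inv_0) (use M M1 K' vals in simp_all)
  qed (use M in simp)
qed

end

subsection \<open>Accuracy and memory\<close>

text \<open>The compounded factor is at most \<open>exp (1 / q)\<close>, and the quadratic term of
  its expansion is at most \<open>1 / q\<close>.\<close>

lemma power_one_plus_le:
  assumes "q > 0"
  shows "(1 + 1 / real (q * b)) ^ b \<le> 1 + 2 / real q"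
proof (cases "b = 0")
  case False
  have "(1 + 1 / real (q * b)) ^ b \<le> exp (1 / real (q * b)) ^ b"
    by (intro power_mono) auto
  also have "\<dots> = exp (1 / real q)"
    using False by (simp flip: exp_of_nat_mult)
  also have "\<dots> \<le> 1 + 1 / real q + (1 / real q)\<^sup>2"
    using assms by (intro exp_bound) auto
  also have "(1 / real q)\<^sup>2 \<le> 1 / real q"
    using assms by (simp add: power2_eq_square field_simps)
  finally show ?thesis by simp
qed simp

text \<open>\<open>vals\<close> is a product so that it dominates the characters and all computed
  numbers at once. The memory bound is a maximum because the uncapped parameter \<open>q0\<close>
  need not lie below \<open>vals\<close>; the capping phase is therefore executed by hand, outside
  the \<open>wp\<close> calculus.\<close>

lemma blockwise_dp_computes:
  assumes n: "length s = n" "length t = n" and chars: "set t \<union> set s \<subseteq> {..<2 ^ w}" and q0: "q0 > 0"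
  defines "q \<equiv> min q0 (4 * n + 1)" and "b \<equiv> (LEAST b. n \<le> b * b)"
  defines "cells \<equiv> b + 2 + nat \<lceil>2 * (real (q * b) + 1) * (1 + ln (real n + 1))\<rceil>"
    and "vals \<equiv> 2 ^ w * (4 * n + 3) * (n + 1)"
  shows "\<exists>D m. computes (Seq cap_param blockwise_dp) q0 t s D m \<and> ed s t \<le> D \<and>
    real D \<le> (1 + 2 / real q) * real (ed s t) \<and>
    m \<le> max (1 + floorlog 2 q0) (20 * cells * (1 + floorlog 2 20 + floorlog 2 cells + floorlog 2 vals))"
proof -
  have b_upper: "n \<le> b * b"
    unfolding b_def by (rule LeastI[of _ n]) simp
  have b_lower: "b' * b' < n" if "b' < b" for b'
    using not_less_Least[OF that[unfolded b_def]] by simp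
  have b_le: "b \<le> n" using b_lower[of n] by (cases "b \<le> n") auto
  have pow: "(2 :: nat) ^ w \<ge> 1" by simp
  have vals_ge: "(4 * n + 3) * (n + 1) \<le> vals"
    unfolding vals_def using mult_le_mono1[OF pow, of "(4 * n + 3) * (n + 1)"] by (simp only: mult_1 mult.assoc)
  have small: "4 * n + 2 < vals"
  proof -
    have "4 * n + 2 < (4 * n + 3) * (n + 1)" by simp
    then show ?thesis using vals_ge by linarith
  qed
  have K_small: "q * b < vals"
  proof -
    have "q * b \<le> (4 * n + 1) * n" using b_le by (intro mult_mono) (auto simp: q_def)
    also have "\<dots> < (4 * n + 3) * (n + 1)" by (rule mult_strict_mono) auto
    finally show ?thesis using vals_ge by linarith
  qed
  interpret sketch t cells vals s q b "q * b"
  proof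
    have "2 ^ w \<le> vals" unfolding vals_def mult.assoc by simp
    then show "set t \<union> set s \<subseteq> {..<vals}" using chars by fastforce
    show "sample_index (q * b) i (length t) < cells" if "i \<le> length t" for i
    proof -
      have "real (sample_index (q * b) i n) \<le> 2 * (real (q * b) + 1) * (1 + ln (real n + 1))"
        using that n by (intro sample_index_le) simp
      also have "\<dots> \<le> real (nat \<lceil>2 * (real (q * b) + 1) * (1 + ln (real n + 1))\<rceil>)"
        by linarith
      finally show ?thesis using n by (simp add: cells_def)
    qed
    show "b < cells" by (simp add: cells_def)
  qed (use n b_upper b_lower small K_small q0 in \<open>auto simp: q_def\<close>)
  let ?start = "upd (\<lambda>_ _. 0) 0 0 q0" and ?capped = "upd (\<lambda>_ _. 0) 0 0 q"
  have space: "space (upd (\<lambda>_ _. 0) 0 0 x) \<le> 1 + floorlog 2 x" for x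
  proof (cases "x = 0")
    case True
    then show ?thesis by (simp add: space_def upd_apply)
  next
    case False
    then have "{(a, i). upd (\<lambda>_ _. 0) 0 0 x a i \<noteq> 0} = {(0, 0)}"
      by (auto simp: upd_apply)
    then show ?thesis by (simp add: space_def upd_apply floorlog_def)
  qed
  have fl: "floorlog 2 q \<le> floorlog 2 q0" by (rule floorlog_mono) (simp add: q_def)
  have "\<exists>m. exec t cap_param ?start s ?capped s m \<and> m \<le> 1 + floorlog 2 q0"
  proof (cases "4 * n + 1 < q0")
    case True
    then have "q = 4 * n + 1" by (simp add: q_def)
    then have M: "?capped = upd ?start 0 0 (4 * n + 1)"
      by (simp add: upd_def)
    have "exec t cap_param ?start s ?capped s (max (space ?start) (space ?capped))"
      unfolding cap_param_def Let_def
    proof (rule exec.CondTrue)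
      show "eval (length t) ?start (Less (Plus (Times (Lit 4) OfflineLength) (Lit 1)) (Var vParam)) \<noteq> 0"
        using True n by simp
      show "exec t (SetVar vParam (Plus (Times (Lit 4) OfflineLength) (Lit 1))) ?start s ?capped s
          (max (space ?start) (space ?capped))"
        by (rule exec.Assign) (use M n in simp)
    qed
    then show ?thesis using space[of q] space[of q0] fl by fastforce
  next
    case False
    then have "q = q0" by (simp add: q_def)
    then have "exec t cap_param ?start s ?capped s (space ?capped)"
      unfolding cap_param_def Let_def using False n
      by (auto intro!: exec.CondFalse exec.Skip simp: upd_apply)
    then show ?thesis using space[of q] fl by fastforce
  qed
  then obtain m1 where m1: "exec t cap_param ?start s ?capped s m1" "m1 \<le> 1 + floorlog 2 q0" by blast
  have "bounded ?capped"
    using small by (auto simp: bounded_def upd_apply q_def)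
  then obtain M' s' m2 where m2: "exec t blockwise_dp ?capped s M' s' m2" "m2 \<le> capacity"
    and D: "ed s t \<le> M' 0 0" "real (M' 0 0) \<le> (1 + 1 / real (q * b)) ^ b * real (ed s t)"
    using wp_blockwise_dp[of ?capped] unfolding wp_def by auto
  have "computes (Seq cap_param blockwise_dp) q0 t s (M' 0 0) (max m1 m2)"
    unfolding computes_def using exec.Seq[OF m1(1) m2(1)] by blast
  moreover have "max m1 m2 \<le> max (1 + floorlog 2 q0) (20 * cells * (1 + floorlog 2 20 + floorlog 2 cells + floorlog 2 vals))"
    using m1(2) m2(2) by (auto simp: capacity_def max_def)
  moreover have "(1 + 1 / real (q * b)) ^ b * real (ed s t) \<le> (1 + 2 / real q) * real (ed s t)"
    using q by (intro mult_right_mono power_one_plus_le) auto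
  ultimately show ?thesis using D by force
qed

lemma floorlog_le_log:
  assumes "x > 0" "real x \<le> y"
  shows "real (floorlog 2 x) \<le> 1 + log 2 y"
proof -
  have "real (floorlog 2 x) = 1 + of_int \<lfloor>log 2 (real x)\<rfloor>"
    using assms by (simp add: floorlog_def)
  also have "\<dots> \<le> 1 + log 2 (real x)" by simp
  also have "log 2 (real x) \<le> log 2 y" using assms by simp
  finally show ?thesis by simp
qed

lemma memory_le:
  fixes n q0 w :: nat
  assumes n: "n \<ge> 2" and w: "w \<ge> 1" and q0: "q0 > 0"
  defines "q \<equiv> min q0 (4 * n + 1)" and "b \<equiv> (LEAST b. n \<le> b * b)"
  defines "cells \<equiv> b + 2 + nat \<lceil>2 * (real (q * b) + 1) * (1 + ln (real n + 1))\<rceil>"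
    and "vals \<equiv> 2 ^ w * (4 * n + 3) * (n + 1)"
  shows "real (max (1 + floorlog 2 q0) (20 * cells * (1 + floorlog 2 20 + floorlog 2 cells + floorlog 2 vals)))
    \<le> 11960 * real q0 * sqrt (real n) * (log 2 (real n))\<^sup>2 * real w"
proof -
  define l where "l = log 2 (real n)"
  define r where "r = sqrt (real n)"
  have l: "1 \<le> l" using n by (simp add: l_def le_log_iff)
  have r: "1 \<le> r" "r \<le> real n" "r * r = real n"
    using n by (auto simp: r_def power2_eq_square intro!: real_le_lsqrt)
  have l_n: "l \<le> real n"
    using n less_exp[of n] unfolding l_def by (simp add: log_le_iff powr_realpow flip: of_nat_le_iff)
  have q: "1 \<le> real q" "real q \<le> real q0" "real q \<le> 5 * real n"
    using q0 n by (auto simp: q_def min_def)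
  have b: "real b \<le> 2 * r"
  proof (cases "b = 0")
    case False
    then have "b - 1 < b" by simp
    then have "(b - 1) * (b - 1) < n"
      using not_less_Least[of "b - 1" "\<lambda>b. n \<le> b * b"] unfolding b_def by simp
    then have "real (b - 1) \<le> r"
      unfolding r_def by (intro real_le_rsqrt) (simp add: power2_eq_square flip: of_nat_mult)
    then show ?thesis using r by simp
  qed (use r in simp)
  \<comment> \<open>The intended order of magnitude of the number of cells per array.\<close>
  define y where "y = real q * r * l"
  have y: "1 \<le> y" "r \<le> y" "real q * r \<le> y"
  proof -
    have *: "r \<le> real q * r" using mult_right_mono[of 1 "real q" r] q r by simp
    moreover have "real q * r \<le> y"
      unfolding y_def using mult_left_mono[of 1 l "real q * r"] q r l by simp
    ultimately show "1 \<le> y" "r \<le> y" "real q * r \<le> y" using r by linarith+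
  qed
  have cells: "real cells \<le> 23 * y"
  proof -
    have K: "real (q * b) + 1 \<le> 3 * (real q * r)"
    proof -
      have "real (q * b) \<le> real q * (2 * r)" using b by (simp add: mult_left_mono)
      moreover have "1 \<le> real q * r" using mult_mono[of 1 "real q" 1 r] q r by simp
      ultimately show ?thesis by simp
    qed
    have "ln (real n + 1) \<le> ln (real n * real n)"
    proof -
      have "real n * real n \<ge> 2 * real n" using n by (intro mult_right_mono) auto
      moreover have "real n \<ge> 2" using n by simp
      ultimately have "real n + 1 \<le> real n * real n" by linarith
      then show ?thesis using n by simp
    qed
    also have "\<dots> = 2 * ln (real n)" using n by (simp add: ln_mult)
    also have "\<dots> \<le> 2 * l"
    proof -
      have "ln 2 \<le> (1 :: real)" using ln_le_minus_one[of 2] by simp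
      then have "ln (real n) * ln 2 \<le> ln (real n)"
        using mult_left_mono[of "ln 2" 1 "ln (real n)"] n by simp
      then show ?thesis using n by (simp add: l_def log_def field_simps)
    qed
    finally have ln: "1 + ln (real n + 1) \<le> 3 * l" using l by simp
    have "2 * (real (q * b) + 1) * (1 + ln (real n + 1)) \<le> 2 * (3 * (real q * r)) * (3 * l)"
      using K ln q r by (intro mult_mono) auto
    also have "\<dots> = 18 * y" by (simp add: y_def)
    finally have "real (nat \<lceil>2 * (real (q * b) + 1) * (1 + ln (real n + 1))\<rceil>) \<le> 18 * y + 1"
      using y by linarith
    \<comment> \<open>The summands of \<open>cells\<close> are at most \<open>2 * y\<close>,
      \<open>2 * y\<close> and \<open>18 * y + 1\<close>, in total at most
      \<open>23 * y\<close>.\<close>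
    then show ?thesis using b y unfolding cells_def by simp
  qed
  have log_numerals: "log 2 128 = (7 :: real)" "log 2 16 = (4 :: real)" "log 2 32 = (5 :: real)"
    using log_nat_power[of 2 2 7] log_nat_power[of 2 2 4] log_nat_power[of 2 2 5] by simp_all
  have fcells: "real (floorlog 2 cells) \<le> 1 + 10 * l"
  proof -
    have "y \<le> 5 * real n * real n * real n"
      unfolding y_def using q r l l_n by (intro mult_mono) auto
    \<comment> \<open>The constant \<open>23 * 5 = 115\<close> is rounded up to a power of
      two.\<close>
    then have "real cells \<le> 2 ^ 7 * real n ^ 3"
      using cells by (simp add: power3_eq_cube)
    then have "real (floorlog 2 cells) \<le> 1 + log 2 (2 ^ 7 * real n ^ 3)"
      by (intro floorlog_le_log) (simp_all add: cells_def)
    also have "\<dots> = 8 + 3 * l"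
      using n by (simp add: log_mult log_nat_power l_def log_numerals)
    finally show ?thesis using l by simp
  qed
  have fvals: "real (floorlog 2 vals) \<le> 1 + 7 * (real w * l)"
  proof -
    have "real vals = 2 ^ w * ((4 * real n + 3) * (real n + 1))" by (simp add: vals_def algebra_simps)
    also have "\<dots> \<le> 2 ^ w * ((8 * real n) * (2 * real n))"
      using n by (intro mult_left_mono mult_mono) auto
    finally have "real vals \<le> 2 ^ w * 2 ^ 4 * real n ^ 2" by (simp add: power2_eq_square)
    then have "real (floorlog 2 vals) \<le> 1 + log 2 (2 ^ w * 2 ^ 4 * real n ^ 2)"
      by (intro floorlog_le_log) (simp_all add: vals_def)
    also have "\<dots> = 5 + real w + 2 * l"
      using n by (simp add: log_mult log_nat_power l_def log_numerals)
    also have "\<dots> \<le> 1 + 7 * (real w * l)"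
    proof -
      have "real w \<le> real w * l" "l \<le> real w * l" "1 \<le> l"
        using mult_left_mono[of 1 l "real w"] mult_right_mono[of 1 "real w" l] w l by auto
      then show ?thesis by linarith
    qed
    finally show ?thesis .
  qed
  have f20: "real (floorlog 2 20) \<le> 6"
  proof -
    have "real (floorlog 2 20) \<le> 1 + log 2 (2 ^ 5)" by (rule floorlog_le_log) auto
    then show ?thesis by (simp add: log_numerals)
  qed
  have wl: "l \<le> real w * l" "1 \<le> real w * l"
    using mult_right_mono[of 1 "real w" l] w l by linarith+
  have "real (20 * cells * (1 + floorlog 2 20 + floorlog 2 cells + floorlog 2 vals))
      = 20 * real cells * (1 + real (floorlog 2 20) + real (floorlog 2 cells) + real (floorlog 2 vals))"
    by (simp only: of_nat_mult of_nat_add of_nat_numeral of_nat_1)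
  \<comment> \<open>In units of \<open>w * l\<close> the bits per cell are at most
    \<open>1 + 6 + 11 + 8 = 26\<close>, and \<open>20 * 23 * 26 = 11960\<close>.\<close>
  also have "\<dots> \<le> 20 * (23 * y) * (26 * (real w * l))"
    using f20 fcells fvals cells y wl by (intro mult_mono) auto
  also have "\<dots> = 11960 * real q * r * l\<^sup>2 * real w"
    by (simp add: y_def power2_eq_square)
  also have "\<dots> \<le> 11960 * real q0 * r * l\<^sup>2 * real w"
    using q r by (intro mult_right_mono mult_left_mono) auto
  finally have 1: "real (20 * cells * (1 + floorlog 2 20 + floorlog 2 cells + floorlog 2 vals))
    \<le> 11960 * real q0 * r * l\<^sup>2 * real w" .
  \<comment> \<open>The capping phase needs about \<open>log 2 q0\<close> bits, absorbed since the
    bound is linear in \<open>q0\<close>.\<close>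
  have "real (1 + floorlog 2 q0) \<le> 2 + real q0"
  proof -
    have "log 2 (real q0) \<le> real q0"
      using q0 less_exp[of q0] by (simp add: log_le_iff powr_realpow flip: of_nat_le_iff)
    then show ?thesis using floorlog_le_log[OF q0 order_refl] by simp
  qed
  also have "\<dots> \<le> 3 * real q0" using q0 by simp
  also have "\<dots> \<le> 11960 * real q0 * 1 * 1 * 1" by simp
  also have "\<dots> \<le> 11960 * real q0 * r * l\<^sup>2 * real w"
    using r l w by (intro mult_mono) auto
  finally show ?thesis using 1 by (simp add: l_def r_def max_def)
qed

lemma ed_le_add: "ed s t \<le> length s + length t"
proof -
  have "ed s t = edit_table ((!) s) ((!) t) (\<lambda>j. j) (length s) (length t)"
    using edit_table_eq_ed[of "length s" s "length t" t] by simp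
  also have "\<dots> \<le> 0 + length s + length t" by (rule edit_table_le) simp
  finally show ?thesis by simp
qed

theorem theorem7:
  shows "\<exists>(P :: prog) (k :: nat). \<forall>\<epsilon>\<^sub>0 :: real. \<epsilon>\<^sub>0 > 0 \<longrightarrow> (\<exists>C :: real. C > 0 \<and>
    (\<forall>\<epsilon> :: real. 0 < \<epsilon> \<and> \<epsilon> \<le> \<epsilon>\<^sub>0 \<longrightarrow> (\<exists>q :: nat.
      \<forall>(n :: nat) (w :: nat) (sbar :: nat list) (s :: nat list).
        w \<ge> 1 \<and> length sbar = n \<and> length s = n \<and> set sbar \<union> set s \<subseteq> {..<2 ^ w} \<longrightarrow>
        (\<exists>D m :: nat. computes P q sbar s D m \<and>
           real (ed s sbar) \<le> real D \<and> real D \<le> (1 + \<epsilon>) * real (ed s sbar) \<and>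
           (n \<ge> 2 \<longrightarrow> real m \<le> C * (log 2 (real n)) ^ k * (sqrt (real n) / \<epsilon>) * real w)))))"
proof (rule exI[of _ "Seq cap_param blockwise_dp"], rule exI[of _ 2], intro allI impI)
  fix \<epsilon>\<^sub>0 :: real
  assume e0: "\<epsilon>\<^sub>0 > 0"
  show "\<exists>C :: real. C > 0 \<and>
    (\<forall>\<epsilon> :: real. 0 < \<epsilon> \<and> \<epsilon> \<le> \<epsilon>\<^sub>0 \<longrightarrow> (\<exists>q :: nat.
      \<forall>(n :: nat) (w :: nat) (sbar :: nat list) (s :: nat list).
        w \<ge> 1 \<and> length sbar = n \<and> length s = n \<and> set sbar \<union> set s \<subseteq> {..<2 ^ w} \<longrightarrow>
        (\<exists>D m :: nat. computes (Seq cap_param blockwise_dp) q sbar s D m \<and>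
           real (ed s sbar) \<le> real D \<and> real D \<le> (1 + \<epsilon>) * real (ed s sbar) \<and>
           (n \<ge> 2 \<longrightarrow> real m \<le> C * (log 2 (real n)) ^ 2 * (sqrt (real n) / \<epsilon>) * real w))))"
  proof (rule exI[of _ "11960 * (2 + \<epsilon>\<^sub>0)"], rule conjI, goal_cases)
    case 1
    then show ?case using e0 by simp
  next
    case 2
    show ?case
    proof (intro allI impI, elim conjE)
      fix \<epsilon> :: real
      assume e: "0 < \<epsilon>" "\<epsilon> \<le> \<epsilon>\<^sub>0"
      define q where "q = nat \<lceil>2 / \<epsilon>\<rceil>"
      have "0 < 2 / \<epsilon>" using e by simp
      then have q: "q > 0" "2 / \<epsilon> \<le> real q" "real q \<le> 2 / \<epsilon> + 1" unfolding q_def by linarith+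
      \<comment> \<open>Rounding \<open>2 / \<epsilon>\<close> up adds at most 1, which becomes a
        multiple of \<open>1 / \<epsilon>\<close> only through the upper bound on \<epsilon>. This
        is the source of the factor \<open>2 + \<epsilon>\<^sub>0\<close>.\<close>
      have "2 / \<epsilon> + 1 \<le> (2 + \<epsilon>\<^sub>0) / \<epsilon>" using e by (simp add: field_simps)
      then have q_le: "real q \<le> (2 + \<epsilon>\<^sub>0) / \<epsilon>" using q by linarith
      have "2 / real q \<le> \<epsilon>" using q e by (simp add: field_simps)
      show "\<exists>q :: nat.
      \<forall>(n :: nat) (w :: nat) (sbar :: nat list) (s :: nat list).
        w \<ge> 1 \<and> length sbar = n \<and> length s = n \<and> set sbar \<union> set s \<subseteq> {..<2 ^ w} \<longrightarrow>
        (\<exists>D m :: nat. computes (Seq cap_param blockwise_dp) q sbar s D m \<and>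
           real (ed s sbar) \<le> real D \<and> real D \<le> (1 + \<epsilon>) * real (ed s sbar) \<and>
           (n \<ge> 2 \<longrightarrow> real m \<le> 11960 * (2 + \<epsilon>\<^sub>0) * (log 2 (real n)) ^ 2 * (sqrt (real n) / \<epsilon>) * real w))"
      proof (rule exI[of _ q], intro allI impI, elim conjE)
        fix n w :: nat and sbar s :: "nat list"
        assume w: "w \<ge> 1" and len: "length sbar = n" "length s = n"
          and chars: "set sbar \<union> set s \<subseteq> {..<2 ^ w}"
        obtain D m where Dm: "computes (Seq cap_param blockwise_dp) q sbar s D m" "ed s sbar \<le> D"
          and D: "real D \<le> (1 + 2 / real (min q (4 * n + 1))) * real (ed s sbar)"
          and m: "n \<ge> 2 \<Longrightarrow> real m \<le> 11960 * real q * sqrt (real n) * (log 2 (real n))\<^sup>2 * real w"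
          using blockwise_dp_computes[OF len(2,1) chars q(1)] memory_le[OF _ w q(1), of n]
          by (meson of_nat_mono order_trans)
        have "real D \<le> (1 + \<epsilon>) * real (ed s sbar)"
        proof (cases "q \<le> 4 * n + 1")
          case True
          then have "real D \<le> (1 + 2 / real q) * real (ed s sbar)" using D by (simp add: min_def)
          also have "\<dots> \<le> (1 + \<epsilon>) * real (ed s sbar)"
            using \<open>2 / real q \<le> \<epsilon>\<close> by (intro mult_right_mono) auto
          finally show ?thesis .
        next
          case False
          \<comment> \<open>With the capped parameter the absolute error is at most
            \<open>4 * n / (4 * n + 1) < 1\<close>, so the integer \<open>D\<close> is
            exact.\<close>
          then have "real D \<le> real (ed s sbar) + 2 / real (4 * n + 1) * real (ed s sbar)"
            using D by (simp add: min_def algebra_simps)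
          also have "2 / real (4 * n + 1) * real (ed s sbar) \<le> 2 / real (4 * n + 1) * real (2 * n)"
            using ed_le_add[of s sbar] len by (intro mult_left_mono) auto
          also have "\<dots> < 1" by (simp add: field_simps)
          finally have "D \<le> ed s sbar" by simp
          then have "real D \<le> 1 * real (ed s sbar)" by simp
          also have "\<dots> \<le> (1 + \<epsilon>) * real (ed s sbar)" using e by (intro mult_right_mono) auto
          finally show ?thesis .
        qed
        moreover have "real m \<le> 11960 * (2 + \<epsilon>\<^sub>0) * (log 2 (real n))\<^sup>2 * (sqrt (real n) / \<epsilon>) * real w"
          if n: "n \<ge> 2"
        proof -
          have "real m \<le> 11960 * real q * sqrt (real n) * (log 2 (real n))\<^sup>2 * real w" by (rule m[OF n])
          also have "\<dots> \<le> 11960 * ((2 + \<epsilon>\<^sub>0) / \<epsilon>) * sqrt (real n) * (log 2 (real n))\<^sup>2 * real w"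
            using q_le by (intro mult_right_mono mult_left_mono) auto
          finally show ?thesis by (simp add: mult_ac)
        qed
        ultimately show "\<exists>D m :: nat. computes (Seq cap_param blockwise_dp) q sbar s D m \<and>
           real (ed s sbar) \<le> real D \<and> real D \<le> (1 + \<epsilon>) * real (ed s sbar) \<and>
           (n \<ge> 2 \<longrightarrow> real m \<le> 11960 * (2 + \<epsilon>\<^sub>0) * (log 2 (real n)) ^ 2 * (sqrt (real n) / \<epsilon>) * real w)"
          using Dm by (meson of_nat_mono)
      qed
    qed
  qed
qed

end
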